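(* In the setting described in the context, let $g(a,\mu)$ be the Lyapunov--Schmidt reduced function at the simple degeneracy, and suppose that $$g_{a\mu}(0,0)\neq 0\qquad\text{and}\qquad g_{aa}(0,0)\neq 0 .$$ Then, after a smooth local change of coordinates, the reduced equation $g(a,\mu)=0$ is equivalent to the transcritical normal form $$a(\mu-\kappa a)+\text{h.o.t.}=0$$ for some $\kappa\neq 0$ (h.o.t. denotes higher-order terms). In particular, there exist two smooth local branches of critical points intersecting at $(a,\mu)=(0,0)$: the trivial branch $a=0$ and a nontrivial branch $$a(\mu)=-\,\frac{2g_{a\mu}(0,0)}{g_{aa}(0,0)}\,\mu+O(\mu^2).$$
   Context: Let $\mathcal M$ be a finite-dimensional Riemannian manifold, $I\subset\mathbb R$ an open interval containing $[0,1]$, and $L\in C^k(\mathcal M\times I,\mathbb R)$ with $k\ge 4$. Write $F(\theta,\lambda):=\nabla_\theta L(\theta,\lambda)$. Assumption (smooth critical branch): there is a smooth map $\theta_0:I\to\mathcal M$ with $F(\theta_0(\lambda),\lambda)=0$ for all $\lambda\in I$. Assumption (simple degeneracy): there is $\lambda^*\in(0,1)$ such that at $\theta^*:=\theta_0(\lambda^* )$ the Hessian $H^*:=\nabla^2_\theta L(\theta^*,\lambda^* )$ has one-dimensional kernel $\mathcal N:=\operatorname{Ker}(H^* )=\operatorname{span}\{v_0\}$, $\|v_0\|=1$. Let $\mathcal R:=\mathcal N^\perp$, so $T_{\theta^*}\mathcal M=\mathcal N\oplus\mathcal R$ orthogonally; $P_{\mathcal N}$, $P_{\mathcal R}$ are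 the orthogonal projections. Straightened coordinates: put $\mu:=\lambda-\lambda^*$. Choose a local chart near $\theta^*$ and, after a smooth change of coordinates, a coordinate $u$ in which the critical branch is $u=0$ for all sufficiently small $\mu$. Let $\widetilde L(u,\mu)$ be the objective in these coordinates and $\widetilde F(u,\mu):=\nabla_u\widetilde L(u,\mu)$, so $\widetilde F(0,\mu)=0$ for all small $|\mu|$, and $\nabla_u^2\widetilde L(0,0)$ is symmetric with kernel $\mathcal N=\operatorname{span}\{v_0\}$. Write $u=av_0+w$ with $a\in\mathbb R$, $w\in\mathcal R$. Reduced function: let $w^*(a,\mu)\in\mathcal R$ be the unique smooth local solution, with $w^*(0,0)=0$, of $P_{\mathcal R}\widetilde F(av_0+w^*(a,\mu),\mu)=0$. Define $g(a,\mu):=P_{\mathcal N}\widetilde F(av_0+w^*(a,\mu),\mu)\cdot v_0$. Zeros of $g$ near $(0,0)$ correspond one-to-one to critical points of $\widetilde L(\cdot,\mu)$ near $(0,0)$. Subscripts on $g$ denote partial derivatives. *)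

theory Defs
  imports "HOL-Analysis.Analysis"
begin

section \<open>Maps of class C^k\<close>

text \<open>Only used on open sets, where \<open>frechet_derivative f (at x)\<close> depends on \<open>f\<close> restricted
  to the set alone.\<close>

fun Ck_on :: "nat \<Rightarrow> 'a::euclidean_space set \<Rightarrow> ('a \<Rightarrow> 'b::real_normed_vector) \<Rightarrow> bool" where
  "Ck_on 0 S f \<longleftrightarrow> continuous_on S f"
| "Ck_on (Suc k) S f \<longleftrightarrow>
     (\<forall>x\<in>S. f differentiable (at x)) \<and> (\<forall>v. Ck_on k S (\<lambda>x. frechet_derivative f (at x) v))"

definition smooth_on :: "'a::euclidean_space set \<Rightarrow> ('a \<Rightarrow> 'b::real_normed_vector) \<Rightarrow> bool" where
  "smooth_on S f \<longleftrightarrow> (\<forall>k. Ck_on k S f)"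

section \<open>Riemannian manifolds\<close>

text \<open>The manifold is the type \<open>'m\<close> with an atlas \<open>A\<close>, modelled on the Euclidean space \<open>'e\<close>.
  A chart is a pair of its domain and its coordinate map.  A tangent vector at a point of a chart
  domain is given by its components, an element of \<open>'e\<close>, in that chart.\<close>

type_synonym ('m, 'e) chart = "'m set \<times> ('m \<Rightarrow> 'e)"

abbreviation chart_inv :: "('m, 'e) chart \<Rightarrow> 'e \<Rightarrow> 'm" where
  "chart_inv c \<equiv> inv_into (fst c) (snd c)"

abbreviation chart_image :: "('m, 'e) chart \<Rightarrow> 'e set" where
  "chart_image c \<equiv> snd c ` fst c"

definition smooth_atlas ::
  "('m::{t2_space,second_countable_topology}, 'e::euclidean_space) chart set \<Rightarrow> bool" where
  "smooth_atlas A \<longleftrightarrow>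
     (\<Union>c\<in>A. fst c) = UNIV \<and>
     (\<forall>c\<in>A. open (fst c) \<and> open (chart_image c) \<and>
        homeomorphism (fst c) (chart_image c) (snd c) (chart_inv c)) \<and>
     (\<forall>c\<in>A. \<forall>d\<in>A. smooth_on (snd c ` (fst c \<inter> fst d)) (snd d \<circ> chart_inv c))"

text \<open>\<open>G c x v w\<close> is the inner product of the tangent vectors with components \<open>v\<close>, \<open>w\<close> in the chart
  \<open>c\<close> at the point with coordinate \<open>x\<close>; the last clause is the transformation law between charts.\<close>

type_synonym ('m, 'e) metric = "('m, 'e) chart \<Rightarrow> 'e \<Rightarrow> 'e \<Rightarrow> 'e \<Rightarrow> real"

definition riemannian_metric ::
  "('m::{t2_space,second_countable_topology}, 'e::euclidean_space) chart set
    \<Rightarrow> ('m, 'e) metric \<Rightarrow> bool" where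
  "riemannian_metric A G \<longleftrightarrow>
     (\<forall>c\<in>A. \<forall>x\<in>chart_image c.
        bilinear (G c x) \<and> (\<forall>v w. G c x v w = G c x w v) \<and> (\<forall>v. v \<noteq> 0 \<longrightarrow> G c x v v > 0)) \<and>
     (\<forall>c\<in>A. \<forall>v w. smooth_on (chart_image c) (\<lambda>x. G c x v w)) \<and>
     (\<forall>c\<in>A. \<forall>d\<in>A. \<forall>x\<in>snd c ` (fst c \<inter> fst d). \<forall>v w.
        let \<tau> = snd d \<circ> chart_inv c; D = frechet_derivative \<tau> (at x)
        in G c x v w = G d (\<tau> x) (D v) (D w))"

definition smooth_into ::
  "('m::{t2_space,second_countable_topology}, 'e::euclidean_space) chart set
    \<Rightarrow> 'x::euclidean_space set \<Rightarrow> ('x \<Rightarrow> 'm) \<Rightarrow> bool" where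
  "smooth_into A S f \<longleftrightarrow>
     continuous_on S f \<and> (\<forall>c\<in>A. smooth_on (S \<inter> f -` fst c) (snd c \<circ> f))"

definition Ck_objective ::
  "nat \<Rightarrow> ('m::{t2_space,second_countable_topology}, 'e::euclidean_space) chart set
    \<Rightarrow> real set \<Rightarrow> ('m \<Rightarrow> real \<Rightarrow> real) \<Rightarrow> bool" where
  "Ck_objective k A I L \<longleftrightarrow>
     (\<forall>c\<in>A. Ck_on k (chart_image c \<times> I) (\<lambda>(x, l). L (chart_inv c x) l))"

text \<open>The vector representing a linear functional with respect to an inner product.\<close>

definition sharp :: "('e \<Rightarrow> 'e \<Rightarrow> real) \<Rightarrow> ('e \<Rightarrow> real) \<Rightarrow> 'e" where
  "sharp B \<phi> = (THE \<xi>. \<forall>w. B \<xi> w = \<phi> w)"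

definition riem_grad ::
  "('m, 'e::euclidean_space) metric \<Rightarrow> ('m, 'e) chart \<Rightarrow> ('m \<Rightarrow> real) \<Rightarrow> 'm \<Rightarrow> 'e" where
  "riem_grad G c f \<theta> =
     sharp (G c (snd c \<theta>)) (frechet_derivative (f \<circ> chart_inv c) (at (snd c \<theta>)))"

text \<open>The Christoffel symbols of the Levi-Civita connection, as a bilinear map: \<open>christoffel G c x v w\<close>
  is the vector with components \<open>\<Gamma>\<^sup>k\<^sub>i\<^sub>j v\<^sup>i w\<^sup>j\<close>.\<close>

definition christoffel ::
  "('m, 'e::euclidean_space) metric \<Rightarrow> ('m, 'e) chart \<Rightarrow> 'e \<Rightarrow> 'e \<Rightarrow> 'e \<Rightarrow> 'e" where
  "christoffel G c x v w = sharp (G c x) (\<lambda>z.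
     (frechet_derivative (\<lambda>y. G c y w z) (at x) v
      + frechet_derivative (\<lambda>y. G c y v z) (at x) w
      - frechet_derivative (\<lambda>y. G c y v w) (at x) z) / 2)"

text \<open>The covariant Hessian \<open>\<nabla>(df)\<close> as a bilinear form, and as the associated endomorphism of the
  tangent space.\<close>

definition riem_hess_form ::
  "('m, 'e::euclidean_space) metric \<Rightarrow> ('m, 'e) chart \<Rightarrow> ('m \<Rightarrow> real) \<Rightarrow> 'm \<Rightarrow> 'e \<Rightarrow> 'e \<Rightarrow> real" where
  "riem_hess_form G c f \<theta> v w =
     (let x = snd c \<theta>; h = f \<circ> chart_inv c in
      frechet_derivative (\<lambda>y. frechet_derivative h (at y) w) (at x) v
      - frechet_derivative h (at x) (christoffel G c x v w))"

definition riem_hess ::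
  "('m, 'e::euclidean_space) metric \<Rightarrow> ('m, 'e) chart \<Rightarrow> ('m \<Rightarrow> real) \<Rightarrow> 'm \<Rightarrow> 'e \<Rightarrow> 'e" where
  "riem_hess G c f \<theta> v = sharp (G c (snd c \<theta>)) (riem_hess_form G c f \<theta> v)"

definition critical_point ::
  "('m, 'e::euclidean_space) chart set \<Rightarrow> ('m, 'e) metric \<Rightarrow> ('m \<Rightarrow> real) \<Rightarrow> 'm \<Rightarrow> bool" where
  "critical_point A G f \<theta> \<longleftrightarrow> (\<forall>c\<in>A. \<theta> \<in> fst c \<longrightarrow> riem_grad G c f \<theta> = 0)"

section \<open>Straightened coordinates and Lyapunov-Schmidt reduction\<close>

text \<open>\<open>\<Phi> (u, \<mu>)\<close> is the point with straightened coordinate \<open>u\<close> at parameter \<open>ls + \<mu>\<close>.  The injectivity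
  and the invertibility of the \<open>u\<close>-derivative say that \<open>(u, \<mu>) \<mapsto> (\<Phi> (u, \<mu>), \<mu>)\<close> is a diffeomorphism
  from \<open>W\<close> onto an open subset of the product of the manifold with the parameter line.  The coordinate
  space \<open>'e\<close> carries its own Euclidean inner product, used for gradients, \<open>\<parallel>v0\<parallel> = 1\<close> and the
  projections below; it is the metric at the base point when the \<open>u\<close>-derivative of \<open>\<Phi>\<close> at the
  origin is isometric, which need not be assumed.\<close>

definition straightening ::
  "('m::{t2_space,second_countable_topology}, 'e::euclidean_space) chart set \<Rightarrow> real set
    \<Rightarrow> (real \<Rightarrow> 'm) \<Rightarrow> real \<Rightarrow> ('e \<times> real) set \<Rightarrow> ('e \<times> real \<Rightarrow> 'm) \<Rightarrow> bool" where
  "straightening A I \<theta>0 ls W \<Phi> \<longleftrightarrow>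
     open W \<and> (0, 0) \<in> W \<and> (\<forall>(u, \<mu>)\<in>W. ls + \<mu> \<in> I) \<and>
     smooth_into A W \<Phi> \<and>
     inj_on (\<lambda>(u, \<mu>). (\<Phi> (u, \<mu>), \<mu>)) W \<and>
     (\<forall>(u, \<mu>)\<in>W. \<forall>c\<in>A. \<Phi> (u, \<mu>) \<in> fst c \<longrightarrow>
        bij (frechet_derivative (\<lambda>u'. snd c (\<Phi> (u', \<mu>))) (at u))) \<and>
     (\<forall>\<mu>. (0, \<mu>) \<in> W \<longrightarrow> \<Phi> (0, \<mu>) = \<theta>0 (ls + \<mu>))"

definition grad :: "('e::real_inner \<Rightarrow> real) \<Rightarrow> 'e \<Rightarrow> 'e" where
  "grad f x = (THE D. GDERIV f x :> D)"

definition straightened_objective ::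
  "('m \<Rightarrow> real \<Rightarrow> real) \<Rightarrow> real \<Rightarrow> ('e \<times> real \<Rightarrow> 'm) \<Rightarrow> 'e \<Rightarrow> real \<Rightarrow> real" where
  "straightened_objective L ls \<Phi> u \<mu> = L (\<Phi> (u, \<mu>)) (ls + \<mu>)"

definition straightened_grad ::
  "('m \<Rightarrow> real \<Rightarrow> real) \<Rightarrow> real \<Rightarrow> ('e \<times> real \<Rightarrow> 'm) \<Rightarrow> 'e::euclidean_space \<Rightarrow> real \<Rightarrow> 'e" where
  "straightened_grad L ls \<Phi> u \<mu> = grad (\<lambda>u'. straightened_objective L ls \<Phi> u' \<mu>) u"

text \<open>Orthogonal projections onto the line spanned by a unit vector \<open>v0\<close> and onto its orthogonal
  complement.\<close>

definition proj_N :: "'e::real_inner \<Rightarrow> 'e \<Rightarrow> 'e" where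
  "proj_N v0 x = (x \<bullet> v0) *\<^sub>R v0"

definition proj_R :: "'e::real_inner \<Rightarrow> 'e \<Rightarrow> 'e" where
  "proj_R v0 x = x - proj_N v0 x"

text \<open>\<open>w\<close> is a local solution, of class C^k near the origin, of the range equation for \<open>F\<close>.  By the
  implicit function theorem its germ is unique when the kernel of the \<open>u\<close>-derivative of \<open>F\<close> at the
  origin is the line spanned by \<open>v0\<close>.\<close>

definition range_solution ::
  "nat \<Rightarrow> ('e::euclidean_space \<times> real) set \<Rightarrow> ('e \<Rightarrow> real \<Rightarrow> 'e) \<Rightarrow> 'e
    \<Rightarrow> (real \<times> real) set \<Rightarrow> (real \<Rightarrow> real \<Rightarrow> 'e) \<Rightarrow> bool" where
  "range_solution k W F v0 V w \<longleftrightarrow>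
     open V \<and> (0, 0) \<in> V \<and> Ck_on k V (\<lambda>(a, \<mu>). w a \<mu>) \<and> w 0 0 = 0 \<and>
     (\<forall>(a, \<mu>)\<in>V. w a \<mu> \<bullet> v0 = 0 \<and> (a *\<^sub>R v0 + w a \<mu>, \<mu>) \<in> W \<and>
        proj_R v0 (F (a *\<^sub>R v0 + w a \<mu>) \<mu>) = 0)"

definition reduced_function ::
  "('e::euclidean_space \<Rightarrow> real \<Rightarrow> 'e) \<Rightarrow> 'e \<Rightarrow> (real \<Rightarrow> real \<Rightarrow> 'e) \<Rightarrow> real \<Rightarrow> real \<Rightarrow> real" where
  "reduced_function F v0 w a \<mu> = proj_N v0 (F (a *\<^sub>R v0 + w a \<mu>) \<mu>) \<bullet> v0"

definition d_aa :: "(real \<Rightarrow> real \<Rightarrow> real) \<Rightarrow> real \<Rightarrow> real \<Rightarrow> real" where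
  "d_aa g a \<mu> = deriv (\<lambda>s. deriv (\<lambda>r. g r \<mu>) s) a"

definition d_amu :: "(real \<Rightarrow> real \<Rightarrow> real) \<Rightarrow> real \<Rightarrow> real \<Rightarrow> real" where
  "d_amu g a \<mu> = deriv (\<lambda>t. deriv (\<lambda>r. g r t) a) \<mu>"

section \<open>Transcritical normal form\<close>

text \<open>Changes of coordinates of bifurcation theory: local diffeomorphisms of the \<open>(a, \<mu>)\<close>-plane
  fixing the origin and of the form \<open>(x, \<nu>) \<mapsto> (X (x, \<nu>), \<Lambda> \<nu>)\<close>, i.e. respecting the role of the
  second variable as a parameter.  For diffeomorphisms mixing state and parameter the condition
  \<open>\<kappa> \<noteq> 0\<close> below would be void.\<close>

definition bifurcation_coordinates ::
  "(real \<times> real) set \<Rightarrow> (real \<times> real \<Rightarrow> real \<times> real) \<Rightarrow> bool" where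
  "bifurcation_coordinates N \<Psi> \<longleftrightarrow>
     open N \<and> (0, 0) \<in> N \<and> smooth_on N \<Psi> \<and> \<Psi> (0, 0) = (0, 0) \<and> inj_on \<Psi> N \<and>
     (\<forall>p\<in>N. bij (frechet_derivative \<Psi> (at p))) \<and>
     (\<exists>\<Lambda>. \<forall>p\<in>N. snd (\<Psi> p) = \<Lambda> (snd p))"

text \<open>In suitable coordinates \<open>(x, \<nu>)\<close>, and up to a nowhere vanishing factor \<open>e\<close>, the function \<open>g\<close> is
  \<open>x (\<nu> - \<kappa> x) + h (x, \<nu>)\<close>, where \<open>h\<close> is of higher (at least third) order at the origin.\<close>

definition transcritical_form ::
  "nat \<Rightarrow> (real \<times> real) set \<Rightarrow> (real \<Rightarrow> real \<Rightarrow> real) \<Rightarrow> real \<Rightarrow> bool" where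
  "transcritical_form k V g \<kappa> \<longleftrightarrow>
     (\<exists>N \<Psi> e h. bifurcation_coordinates N \<Psi> \<and> \<Psi> ` N \<subseteq> V \<and>
        Ck_on k N e \<and> (\<forall>p\<in>N. e p \<noteq> 0) \<and>
        Ck_on k N h \<and> h \<in> O[at (0, 0)](\<lambda>p. norm p ^ 3) \<and>
        (\<forall>(x, \<nu>)\<in>N. case_prod g (\<Psi> (x, \<nu>)) = e (x, \<nu>) * (x * (\<nu> - \<kappa> * x) + h (x, \<nu>))))"

end

theory Submission
  imports Defs
begin

text \<open>Symmetry of the Hessian makes \<open>(u, \<mu>) \<mapsto> (P\<^sub>R F(u, \<mu>) + (u \<bullet> v0) v0, \<mu>)\<close> a local diffeomorphism, so
  the range equation has at most one solution with given \<open>(a, \<mu>)\<close>; comparing with the trivial branch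
  gives \<open>w(0, \<mu>) = 0\<close> and hence \<open>g(0, \<mu>) = 0\<close>.  Hadamard's lemma factors \<open>g = a q\<close> with
  \<open>q(a, \<mu>) = \<integral>\<^sub>0\<^sup>1 g\<^sub>a(t a, \<mu>) dt\<close>, where \<open>q(0, 0) = 0\<close>, \<open>q\<^sub>\<mu>(0, 0) = g\<^sub>a\<^sub>\<mu>(0, 0)\<close> and \<open>q\<^sub>a(0, 0) = g\<^sub>a\<^sub>a(0, 0) / 2\<close>.
  The implicit function theorem for \<open>q = 0\<close> yields the nontrivial branch.  The normal form needs no
  change of coordinates: since \<open>g\<close> is of class \<open>C\<^sup>3\<close>, dividing by the constant \<open>g\<^sub>a\<^sub>\<mu>(0, 0)\<close> leaves
  \<open>a (\<mu> - \<kappa> a)\<close> with \<open>\<kappa> = - g\<^sub>a\<^sub>a(0, 0) / (2 g\<^sub>a\<^sub>\<mu>(0, 0))\<close> and a remainder of third order.\<close>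

section \<open>Calculus of C^k maps\<close>

text \<open>The degeneracy is stated with the Riemannian Hessian in a chart, the reduction with
  Euclidean gradients in straightened coordinates. The two inner products need not agree, so only
  metric-free data are transferred: vanishing of a differential, and the kernel of the Hessian at a
  critical point. There the Christoffel term and the second derivative of the coordinate change are
  both multiplied by the vanishing differential.

  The function \<open>w\<close> is given as a solution of the range equation and not constructed, so
  local uniqueness is the fact to prove. Symmetry of the Euclidean Hessian H enters twice: it puts
  the range of H inside the complement of \<open>v0\<close>, and it gives g_a(0, 0) = (v0 + w_a) . H
  v0 = 0, which is why q vanishes at the origin.

  Derivatives are lost twice: F and g are of class k - 1, q and the nontrivial branch of class k -
  2. With k at least 4 the factor q is still C^2, as its quadratic Taylor remainder
  requires.\<close>

lemma Ck_on_cong: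
  assumes "open S" "\<And>x. x \<in> S \<Longrightarrow> f x = g x" "Ck_on n S f"
  shows "Ck_on n S g"
  using assms(2,3)
proof (induction n arbitrary: f g)
  case 0
  then show ?case by (metis Ck_on.simps(1) continuous_on_cong)
next
  case (Suc n)
  \<comment> \<open>Agreement on an open set passes to the derivatives at its points, so the
    induction hypothesis applies to the directional derivatives.\<close>
  have d: "(g has_derivative frechet_derivative f (at x)) (at x)" if "x \<in> S" for x
    using Suc.prems that assms(1)
    by (auto intro!: has_derivative_transform_within_open[of f _ x UNIV S g]
        simp: frechet_derivative_works[symmetric])
  have e: "frechet_derivative g (at x) = frechet_derivative f (at x)" if "x \<in> S" for x
    using frechet_derivative_at[OF d[OF that]] by simp
  have "Ck_on n S (\<lambda>x. frechet_derivative g (at x) v)" for v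
    by (rule Suc.IH[of "\<lambda>x. frechet_derivative f (at x) v"]) (use Suc.prems e in auto)
  moreover have "g differentiable (at x)" if "x \<in> S" for x
    using d[OF that] unfolding differentiable_def by blast
  ultimately show ?case by simp
qed

lemma Ck_on_subset:
  assumes "Ck_on n S f" "T \<subseteq> S"
  shows "Ck_on n T f"
  using assms(1)
proof (induction n arbitrary: f)
  case 0
  then show ?case using assms(2) by (auto intro: continuous_on_subset)
next
  case (Suc n)
  then show ?case using assms(2) by (simp add: subset_iff)
qed

lemma Ck_on_SucD: "Ck_on (Suc n) S f \<Longrightarrow> Ck_on n S f"
proof (induction n arbitrary: f)
  case 0
  then show ?case
    by (auto intro!: continuous_at_imp_continuous_on differentiable_imp_continuous_within)
next
  case (Suc n)
  then show ?case by (metis Ck_on.simps(2))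
qed

lemma Ck_on_le:
  assumes "Ck_on n S f" "m \<le> n"
  shows "Ck_on m S f"
  using assms(2,1) by (induction n rule: dec_induct) (blast dest: Ck_on_SucD)+

lemma Ck_on_imp_continuous_on: "Ck_on n S f \<Longrightarrow> continuous_on S f"
  using Ck_on_le[of n S f 0] by simp

lemma Ck_on_has_derivative:
  assumes "Ck_on n S f" "0 < n" "x \<in> S"
  shows "(f has_derivative frechet_derivative f (at x)) (at x)"
  using Ck_on_le[OF assms(1), of 1] assms(2,3) by (auto simp: frechet_derivative_works[symmetric])

lemma Ck_on_derivative: "Ck_on (Suc n) S f \<Longrightarrow> Ck_on n S (\<lambda>x. frechet_derivative f (at x) v)"
  by simp

text \<open>Lets smoothness be proved with any explicit formula for the derivative; uniqueness of
  derivatives identifies it with \<open>frechet_derivative\<close> on the open set.\<close>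

lemma Ck_on_SucI:
  assumes "open S" "\<And>x. x \<in> S \<Longrightarrow> (f has_derivative f' x) (at x)"
    and "\<And>v. Ck_on n S (\<lambda>x. f' x v)"
  shows "Ck_on (Suc n) S f"
proof -
  have "f' x = frechet_derivative f (at x)" if "x \<in> S" for x
    using frechet_derivative_at[OF assms(2)[OF that]] .
  then have "Ck_on n S (\<lambda>x. frechet_derivative f (at x) v)" for v
    by (intro Ck_on_cong[OF assms(1) _ assms(3)[of v]]) auto
  then show ?thesis
    using assms(2) by (auto simp: differentiable_def)
qed

text \<open>\<open>frechet_derivative\<close> is taken at a point of the whole space, so every
  clause of \<open>Ck_on\<close> can be checked in a neighbourhood. This permits verification chart
  by chart.\<close>

lemma Ck_on_local:
  assumes "\<And>x. x \<in> S \<Longrightarrow> \<exists>T. open T \<and> x \<in> T \<and> Ck_on n T f"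
  shows "Ck_on n S f"
  using assms
proof (induction n arbitrary: f)
  case 0
  have "isCont f x" if "x \<in> S" for x
    using 0[OF that] by (auto simp: continuous_on_eq_continuous_at)
  then show ?case by (simp add: continuous_at_imp_continuous_on)
next
  case (Suc n)
  have "f differentiable (at x)" if "x \<in> S" for x
    using Suc.prems[OF that] by auto
  moreover have "Ck_on n S (\<lambda>x. frechet_derivative f (at x) v)" for v
  proof (rule Suc.IH)
    fix x assume "x \<in> S"
    from Suc.prems[OF this] show "\<exists>T. open T \<and> x \<in> T \<and> Ck_on n T (\<lambda>x. frechet_derivative f (at x) v)"
      by auto
  qed
  ultimately show ?case by simp
qed

section \<open>Closure of C^k maps under algebra, composition and reciprocals\<close>

lemma Ck_on_const [simp]: "Ck_on n S (\<lambda>x. c)"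
  by (induction n arbitrary: c) (auto simp: frechet_derivative_const)

lemma Ck_on_bounded_linear:
  assumes "bounded_linear h"
  shows "Ck_on n S h"
proof (cases n)
  case 0
  then show ?thesis using assms by (simp add: linear_continuous_on)
next
  case (Suc m)
  have "frechet_derivative h (at x) = h" for x
    using frechet_derivative_at[OF bounded_linear_imp_has_derivative[OF assms]] by simp
  then show ?thesis
    using Suc assms by (simp add: bounded_linear_imp_differentiable)
qed

lemma Ck_on_linear_compose:
  assumes "open S" "bounded_linear h" "Ck_on n S f"
  shows "Ck_on n S (\<lambda>x. h (f x))"
  using assms(3)
proof (induction n arbitrary: f)
  case 0
  then show ?case using assms(2) by (simp add: linear_continuous_on_compose bounded_linear.continuous_on)
next
  case (Suc n)
  show ?case
  proof (rule Ck_on_SucI[OF assms(1)])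
    show "((\<lambda>x. h (f x)) has_derivative (\<lambda>v. h (frechet_derivative f (at x) v))) (at x)" if "x \<in> S" for x
      using bounded_linear.has_derivative[OF assms(2) Ck_on_has_derivative[OF Suc.prems _ that]] by simp
    show "Ck_on n S (\<lambda>x. h (frechet_derivative f (at x) v))" for v
      using Suc by simp
  qed
qed

lemma Ck_on_add:
  assumes "open S" "Ck_on n S f" "Ck_on n S g"
  shows "Ck_on n S (\<lambda>x. f x + g x)"
  using assms(2,3)
proof (induction n arbitrary: f g)
  case 0
  then show ?case by (simp add: continuous_on_add)
next
  case (Suc n)
  show ?case
  proof (rule Ck_on_SucI[OF assms(1)])
    show "((\<lambda>x. f x + g x) has_derivative
      (\<lambda>v. frechet_derivative f (at x) v + frechet_derivative g (at x) v)) (at x)" if "x \<in> S" for x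
      using Ck_on_has_derivative[OF Suc.prems(1) _ that] Ck_on_has_derivative[OF Suc.prems(2) _ that]
      by (simp add: has_derivative_add)
    show "Ck_on n S (\<lambda>x. frechet_derivative f (at x) v + frechet_derivative g (at x) v)" for v
      using Suc by simp
  qed
qed

lemma Ck_on_sum:
  assumes "open S" "\<And>i. i \<in> B \<Longrightarrow> Ck_on n S (f i)"
  shows "Ck_on n S (\<lambda>x. \<Sum>i\<in>B. f i x)"
  using assms(2)
  by (induction B rule: infinite_finite_induct) (auto intro!: Ck_on_add[OF assms(1)])

text \<open>Each term of the product rule pairs an undifferentiated factor with a derivative; hence
  the induction over both factors at once, with the undifferentiated one lowered by one
  order.\<close>

lemma Ck_on_bilinear:
  assumes "open S" "bounded_bilinear p" "Ck_on n S f" "Ck_on n S g"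
  shows "Ck_on n S (\<lambda>x. p (f x) (g x))"
  using assms(3,4)
proof (induction n arbitrary: f g)
  case 0
  then show ?case using assms(2) by (simp add: bounded_bilinear.continuous_on)
next
  case (Suc n)
  show ?case
  proof (rule Ck_on_SucI[OF assms(1)])
    show "((\<lambda>x. p (f x) (g x)) has_derivative
      (\<lambda>v. p (f x) (frechet_derivative g (at x) v) + p (frechet_derivative f (at x) v) (g x))) (at x)"
      if "x \<in> S" for x
      using Ck_on_has_derivative[OF Suc.prems(1) _ that] Ck_on_has_derivative[OF Suc.prems(2) _ that]
      by (simp add: bounded_bilinear.FDERIV[OF assms(2)])
    show "Ck_on n S (\<lambda>x. p (f x) (frechet_derivative g (at x) v) + p (frechet_derivative f (at x) v) (g x))" for v
      using Suc.prems Ck_on_SucD[OF Suc.prems(1)] Ck_on_SucD[OF Suc.prems(2)]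
      by (intro Ck_on_add[OF assms(1)] Suc.IH) auto
  qed
qed

lemmas Ck_on_scaleR = Ck_on_bilinear[OF _ bounded_bilinear_scaleR]
lemmas Ck_on_inner = Ck_on_bilinear[OF _ bounded_bilinear_inner]
lemmas Ck_on_mult = Ck_on_bilinear[OF _ bounded_bilinear_mult]

lemma Ck_on_diff:
  assumes "open S" "Ck_on n S f" "Ck_on n S g"
  shows "Ck_on n S (\<lambda>x. f x - g x)"
proof -
  have "Ck_on n S (\<lambda>x. - g x)"
    by (rule Ck_on_linear_compose[OF assms(1) _ assms(3)])
      (simp add: bounded_linear_minus bounded_linear_ident)
  from Ck_on_add[OF assms(1,2) this] show ?thesis by simp
qed

lemma Ck_on_Pair:
  fixes f :: "'a::euclidean_space \<Rightarrow> 'b::real_normed_vector" and g :: "'a \<Rightarrow> 'c::real_normed_vector"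
  assumes "open S" "Ck_on n S f" "Ck_on n S g"
  shows "Ck_on n S (\<lambda>x. (f x, g x))"
proof -
  have "bounded_linear (\<lambda>y::'b. (y, 0::'c))" "bounded_linear (\<lambda>y::'c. (0::'b, y))"
    by (intro bounded_linear_Pair bounded_linear_ident bounded_linear_zero)+
  from Ck_on_add[OF assms(1) Ck_on_linear_compose[OF assms(1) this(1) assms(2)]
      Ck_on_linear_compose[OF assms(1) this(2) assms(3)]]
  show ?thesis by simp
qed

lemma Ck_on_fst: "Ck_on n S fst" and Ck_on_snd: "Ck_on n S snd"
  by (simp_all add: Ck_on_bounded_linear bounded_linear_fst bounded_linear_snd)

lemma Ck_on_ident: "Ck_on n S (\<lambda>x. x)"
  by (simp add: Ck_on_bounded_linear bounded_linear_ident)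

text \<open>\<open>Ck_on\<close> only controls derivatives in fixed directions. This expansion
  replaces a direction that moves with the point by fixed basis directions with moving
  coefficients.\<close>

lemma linear_euclidean_sum:
  fixes x :: "'a::euclidean_space"
  assumes "linear f"
  shows "f x = (\<Sum>b\<in>Basis. (x \<bullet> b) *\<^sub>R f b)"
proof -
  have "f (\<Sum>b\<in>Basis. (x \<bullet> b) *\<^sub>R b) = (\<Sum>b\<in>Basis. (x \<bullet> b) *\<^sub>R f b)"
    by (simp only: linear_sum[OF assms] linear_cmul[OF assms])
  then show ?thesis by (simp only: euclidean_representation)
qed

text \<open>The induction keeps \<open>g\<close> fixed and varies \<open>f\<close>: the chain rule
  leads to the compositions of the partial derivatives of \<open>f\<close> with the same
  \<open>g\<close>.\<close>

lemma Ck_on_compose: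
  fixes f :: "'b::euclidean_space \<Rightarrow> 'c::real_normed_vector" and g :: "'a::euclidean_space \<Rightarrow> 'b"
  assumes "open S" "Ck_on n S g" "g ` S \<subseteq> T" "Ck_on n T f"
  shows "Ck_on n S (\<lambda>x. f (g x))"
  using assms(2,4)
proof (induction n arbitrary: f)
  case 0
  then show ?case using assms(3) by (auto intro: continuous_on_compose2)
next
  case (Suc n)
  let ?D = "\<lambda>h x. frechet_derivative h (at x)"
  show ?case
  proof (rule Ck_on_SucI[OF assms(1)])
    show "((\<lambda>x. f (g x)) has_derivative
      (\<lambda>v. \<Sum>b\<in>Basis. (?D g x v \<bullet> b) *\<^sub>R ?D f (g x) b)) (at x)"
      if "x \<in> S" for x
    proof -
      have f: "(f has_derivative ?D f (g x)) (at (g x))"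
        using Ck_on_has_derivative[OF Suc.prems(2)] that assms(3) by auto
      have "((\<lambda>x. f (g x)) has_derivative (\<lambda>v. ?D f (g x) (?D g x v))) (at x)"
        using has_derivative_compose[OF Ck_on_has_derivative[OF Suc.prems(1) _ that] f] by simp
      then show ?thesis
        by (simp only: linear_euclidean_sum[OF has_derivative_linear[OF f], symmetric])
    qed
    show "Ck_on n S (\<lambda>x. \<Sum>b\<in>Basis. (?D g x v \<bullet> b) *\<^sub>R ?D f (g x) b)" for v
      using Suc.prems Ck_on_SucD[OF Suc.prems(1)]
      by (intro Ck_on_sum Ck_on_scaleR Ck_on_inner Suc.IH assms(1)) auto
  qed
qed

lemma Ck_on_inverse:
  fixes f :: "'a::euclidean_space \<Rightarrow> real"
  assumes "open S" "Ck_on n S f" "\<And>x. x \<in> S \<Longrightarrow> f x \<noteq> 0"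
  shows "Ck_on n S (\<lambda>x. inverse (f x))"
  using assms(2)
proof (induction n)
  case 0
  then show ?case using assms(3) by (auto intro: continuous_on_inverse)
next
  case (Suc n)
  show ?case
  proof (rule Ck_on_SucI[OF assms(1)])
    show "((\<lambda>x. inverse (f x)) has_derivative
      (\<lambda>v. -1 * (inverse (f x) * frechet_derivative f (at x) v * inverse (f x)))) (at x)" if "x \<in> S" for x
      using Deriv.has_derivative_inverse[OF assms(3)[OF that] Ck_on_has_derivative[OF Suc.prems _ that]] by simp
    show "Ck_on n S (\<lambda>x. -1 * (inverse (f x) * frechet_derivative f (at x) v * inverse (f x)))" for v
      using Suc.prems Suc.IH[OF Ck_on_SucD[OF Suc.prems]] assms(1)
      by (intro Ck_on_mult) auto
  qed
qed

text \<open>In finite dimension continuity on each basis vector gives continuity in operator norm,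
  the form in which the inverse function theorem wants the derivative.\<close>

lemma continuous_on_Blinfun_derivative:
  assumes "Ck_on (Suc n) S f"
  shows "continuous_on S (\<lambda>x. Blinfun (frechet_derivative f (at x)))"
proof (rule continuous_on_blinfun_componentwise)
  fix b
  have "continuous_on S (\<lambda>x. frechet_derivative f (at x) b)"
    using Ck_on_imp_continuous_on Ck_on_derivative[OF assms] by blast
  then show "continuous_on S (\<lambda>x. blinfun_apply (Blinfun (frechet_derivative f (at x))) b)"
    by (rule continuous_on_eq)
      (metis Ck_on_has_derivative[OF assms zero_less_Suc] bounded_linear_Blinfun_apply has_derivative_bounded_linear)
qed

text \<open>Differentiation under the integral. The open \<open>U\<close> around the compact
  interval makes \<open>f\<close> smooth on an open product, so the induction can pass to its
  derivative in the direction (v, 0).\<close>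

lemma Ck_on_integral:
  fixes f :: "'a::euclidean_space \<times> real \<Rightarrow> 'c::banach"
  assumes "open S" "convex S" "open U" "{a..b} \<subseteq> U" "Ck_on n (S \<times> U) f"
  shows "Ck_on n S (\<lambda>x. integral {a..b} (\<lambda>t. f (x, t)))"
  using assms(5)
proof (induction n arbitrary: f)
  case 0
  then have "continuous_on (S \<times> cbox a b) (\<lambda>(x, t). f (x, t))"
    using assms(4) by (auto intro: continuous_on_subset)
  from integral_continuous_on_param[OF this] show ?case by simp
next
  case (Suc n)
  let ?D = "\<lambda>x t. frechet_derivative f (at (x, t)) \<circ> (\<lambda>v. (v, 0))"
  have lin: "bounded_linear (\<lambda>v. (v, 0::real))"
    by (intro bounded_linear_Pair bounded_linear_ident bounded_linear_zero)
  have D: "((\<lambda>x. f (x, t)) has_derivative ?D x t) (at x)" if "x \<in> S" "t \<in> U" for x t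
  proof -
    have "(f has_derivative frechet_derivative f (at (x, t))) (at (x, t))"
      using Ck_on_has_derivative[OF Suc.prems] that by auto
    moreover have "((\<lambda>x. (x, t)) has_derivative (\<lambda>v. (v, 0))) (at x)"
      by (auto intro!: derivative_eq_intros)
    ultimately show ?thesis
      using diff_chain_at[of "\<lambda>x. (x, t)"] by (simp add: o_def)
  qed
  have bl: "blinfun_apply (Blinfun (?D x t)) = ?D x t" if "x \<in> S" "t \<in> U" for x t
    using D[OF that] by (simp add: bounded_linear_Blinfun_apply has_derivative_bounded_linear)
  have cd: "continuous_on (S \<times> U) (\<lambda>x. frechet_derivative f (at x) v)" for v
    using Ck_on_imp_continuous_on[OF Ck_on_derivative[OF Suc.prems]] .
  have cB: "continuous_on (S \<times> U) (\<lambda>z. Blinfun (?D (fst z) (snd z)))"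
  proof (rule continuous_on_blinfun_componentwise)
    show "continuous_on (S \<times> U) (\<lambda>z. blinfun_apply (Blinfun (?D (fst z) (snd z))) i)" for i
      by (rule continuous_on_eq[OF cd[of "(i, 0)"]]) (auto simp: bl)
  qed
  have int: "(\<lambda>t. h (x, t)) integrable_on {a..b}" if "continuous_on (S \<times> U) h" "x \<in> S"
    for h :: "'a \<times> real \<Rightarrow> 'd::banach" and x
  proof (rule integrable_continuous_real)
    show "continuous_on {a..b} (\<lambda>t. h (x, t))"
      using that assms(4) by (auto intro!: continuous_on_compose2[OF that(1)] continuous_intros)
  qed
  show ?case
  proof (rule Ck_on_SucI[OF assms(1)])
    fix x assume x: "x \<in> S"
    have "((\<lambda>x. integral (cbox a b) (\<lambda>t. f (x, t))) has_derivative
      integral (cbox a b) (\<lambda>t. Blinfun (?D x t))) (at x within S)"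
    proof (rule leibniz_rule)
      show "((\<lambda>x. f (x, t)) has_derivative Blinfun (?D x t)) (at x within S)"
        if "x \<in> S" "t \<in> cbox a b" for x t
      proof -
        have "t \<in> U" using that assms(4) by auto
        then show ?thesis
          using D[OF that(1)] bl[OF that(1)] by (simp add: has_derivative_at_withinI)
      qed
      show "(\<lambda>t. f (x, t)) integrable_on cbox a b" if "x \<in> S" for x
        using int[OF Ck_on_imp_continuous_on[OF Suc.prems] that] by simp
      show "continuous_on (S \<times> cbox a b) (\<lambda>(x, t). Blinfun (?D x t))"
        unfolding case_prod_unfold by (rule continuous_on_subset[OF cB]) (use assms(4) in auto)
    qed (use x assms in auto)
    then have "((\<lambda>x. integral {a..b} (\<lambda>t. f (x, t))) has_derivative
      (\<lambda>v. blinfun_apply (integral (cbox a b) (\<lambda>t. Blinfun (?D x t))) v)) (at x)"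
      unfolding at_within_open[OF x assms(1)] box_real .
    moreover have "blinfun_apply (integral (cbox a b) (\<lambda>t. Blinfun (?D x t))) v
        = integral {a..b} (\<lambda>t. frechet_derivative f (at (x, t)) (v, 0))" for v
    proof -
      have "(\<lambda>t. Blinfun (?D x t)) integrable_on {a..b}"
        using int[OF cB x] by simp
      then have "blinfun_apply (integral {a..b} (\<lambda>t. Blinfun (?D x t))) v
        = integral {a..b} (\<lambda>t. blinfun_apply (Blinfun (?D x t)) v)"
        by (rule blinfun_apply_integral)
      also have "\<dots> = integral {a..b} (\<lambda>t. frechet_derivative f (at (x, t)) (v, 0))"
        by (rule integral_cong) (use bl x assms(4) in auto)
      finally show ?thesis by simp
    qed
    ultimately show "((\<lambda>x. integral {a..b} (\<lambda>t. f (x, t))) has_derivative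
      (\<lambda>v. integral {a..b} (\<lambda>t. frechet_derivative f (at (x, t)) (v, 0)))) (at x)"
      by (simp only:)
  next
    show "Ck_on n S (\<lambda>x. integral {a..b} (\<lambda>t. frechet_derivative f (at (x, t)) (v, 0)))" for v
      by (rule Suc.IH[OF Ck_on_derivative[OF Suc.prems]])
  qed
qed

section \<open>Second derivatives and the implicit function theorem\<close>

text \<open>The second difference is symmetric in \<open>v\<close> and \<open>w\<close>, but here it
  is approximated by one of the two mixed derivatives; comparing both choices will give
  symmetry.\<close>

lemma second_difference_bound:
  fixes f :: "'a::euclidean_space \<Rightarrow> 'b::real_normed_vector" and v w :: 'a
  assumes "open S" "x \<in> S" "Ck_on 2 S f" "\<epsilon> > 0"
  defines "A \<equiv> frechet_derivative (\<lambda>y. frechet_derivative f (at y) v) (at x)"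
  shows "\<exists>\<delta>>0. \<forall>t. 0 < t \<and> t < \<delta> \<longrightarrow>
    norm (f (x + t *\<^sub>R v + t *\<^sub>R w) - f (x + t *\<^sub>R v) - f (x + t *\<^sub>R w) + f x - t\<^sup>2 *\<^sub>R A w) \<le> \<epsilon> * t\<^sup>2"
proof -
  have f: "Ck_on (Suc (Suc 0)) S f" using assms(3) by (simp add: numeral_2_eq_2)
  define P where "P y = frechet_derivative f (at y) v" for y
  \<comment> \<open>The displacements below have norms at most t (|v| + |w|) and t |v|;
    \<open>C\<close> bounds the sum of the two factors, and the extra 1 keeps it positive.\<close>
  define C where "C = 2 * norm v + norm w + 1"
  define e where "e = \<epsilon> / C"
  have C: "C > 0" by (simp add: C_def add_nonneg_pos)
  have e: "e > 0" using C assms(4) by (simp add: e_def)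
  have Df: "(f has_derivative frechet_derivative f (at y)) (at y)" if "y \<in> S" for y
    using Ck_on_has_derivative[OF f _ that] by simp
  have P: "(P has_derivative A) (at x)"
    unfolding P_def A_def by (rule Ck_on_has_derivative[OF Ck_on_derivative[OF f] _ assms(2)]) simp
  then have linA: "linear A" by (rule has_derivative_linear)
  obtain d1 where d1: "d1 > 0" "\<And>y. norm (y - x) < d1 \<Longrightarrow> norm (P y - P x - A (y - x)) \<le> e * norm (y - x)"
    using P e unfolding has_derivative_at_alt by blast
  obtain d2 where d2: "d2 > 0" "ball x d2 \<subseteq> S"
    using assms(1,2) open_contains_ball by blast
  define \<delta> where "\<delta> = min d1 d2 / C"
  have \<delta>: "\<delta> > 0" using C d1 d2 by (simp add: \<delta>_def)
  have "norm (f (x + t *\<^sub>R v + t *\<^sub>R w) - f (x + t *\<^sub>R v) - f (x + t *\<^sub>R w) + f x - t\<^sup>2 *\<^sub>R A w) \<le> \<epsilon> * t\<^sup>2"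
    if t: "0 < t" "t < \<delta>" for t
  proof -
    \<comment> \<open>Subtracting the term linear in \<open>s\<close> makes the derivative of \<phi>
      small, so the mean value bound on [0, t] replaces a second-order expansion of
      \<open>f\<close>.\<close>
    define \<phi> where "\<phi> s = f (x + s *\<^sub>R v + t *\<^sub>R w) - f (x + s *\<^sub>R v) - s *\<^sub>R (t *\<^sub>R A w)" for s
    have tC: "t * C < min d1 d2" using t C by (simp add: \<delta>_def field_simps)
    define c where "c s = P (x + s *\<^sub>R v + t *\<^sub>R w) - P (x + s *\<^sub>R v) - t *\<^sub>R A w" for s
    have nrm: "norm (s *\<^sub>R v + t *\<^sub>R w) \<le> t * (norm v + norm w)" "norm (s *\<^sub>R v) \<le> t * norm v" if "s \<in> {0..t}" for s
    proof -
      have "s * norm v \<le> t * norm v" using that by (auto intro: mult_right_mono)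
      then show "norm (s *\<^sub>R v) \<le> t * norm v" using that by simp
      then show "norm (s *\<^sub>R v + t *\<^sub>R w) \<le> t * (norm v + norm w)"
        using norm_triangle_ineq[of "s *\<^sub>R v" "t *\<^sub>R w"] t by (simp add: algebra_simps)
    qed
    have lt: "norm (s *\<^sub>R v + t *\<^sub>R w) < min d1 d2" "norm (s *\<^sub>R v) < min d1 d2" if "s \<in> {0..t}" for s
    proof -
      have "t * (norm v + norm w) \<le> t * C" "t * norm v \<le> t * C"
        using t by (auto simp: C_def intro!: mult_left_mono add_increasing2)
      then show "norm (s *\<^sub>R v + t *\<^sub>R w) < min d1 d2" "norm (s *\<^sub>R v) < min d1 d2"
        using nrm[OF that] tC by linarith+
    qed
    have mem: "x + s *\<^sub>R v + t *\<^sub>R w \<in> S" "x + s *\<^sub>R v \<in> S" if "s \<in> {0..t}" for s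
    proof -
      have "dist x (x + s *\<^sub>R v + t *\<^sub>R w) < d2" "dist x (x + s *\<^sub>R v) < d2"
        using lt[OF that] by (simp_all add: dist_norm norm_minus_commute algebra_simps)
      then show "x + s *\<^sub>R v + t *\<^sub>R w \<in> S" "x + s *\<^sub>R v \<in> S"
        using d2 by auto
    qed
    have der: "(\<phi> has_derivative (\<lambda>h. h *\<^sub>R c s)) (at s within {0..t})" if "s \<in> {0..t}" for s
    proof -
      have "((\<lambda>s. f (x + s *\<^sub>R v + t *\<^sub>R w)) has_derivative
          (\<lambda>h. frechet_derivative f (at (x + s *\<^sub>R v + t *\<^sub>R w)) (h *\<^sub>R v))) (at s within {0..t})"
        by (rule has_derivative_compose[of "\<lambda>s. x + s *\<^sub>R v + t *\<^sub>R w" "\<lambda>h. h *\<^sub>R v" s "{0..t}" f, OF _ Df[OF mem(1)[OF that]]]) (auto intro!: derivative_eq_intros)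
      moreover have "((\<lambda>s. f (x + s *\<^sub>R v)) has_derivative
          (\<lambda>h. frechet_derivative f (at (x + s *\<^sub>R v)) (h *\<^sub>R v))) (at s within {0..t})"
        by (rule has_derivative_compose[of "\<lambda>s. x + s *\<^sub>R v" "\<lambda>h. h *\<^sub>R v" s "{0..t}" f, OF _ Df[OF mem(2)[OF that]]]) (auto intro!: derivative_eq_intros)
      ultimately show ?thesis
        unfolding \<phi>_def c_def P_def
        by (auto intro!: derivative_eq_intros simp: fun_eq_iff scaleR_diff_right
            linear_cmul[OF has_derivative_linear[OF Df[OF mem(1)[OF that]]]]
            linear_cmul[OF has_derivative_linear[OF Df[OF mem(2)[OF that]]]])
    qed
    have bnd: "onorm (\<lambda>h. h *\<^sub>R c s) \<le> \<epsilon> * t" if s: "s \<in> {0..t}" for s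
    proof (rule onorm_le)
      fix h :: real
      \<comment> \<open>The increments s v + t w and s v differ by t w, so \<open>c s\<close> is a
        difference of two first-order remainders of \<open>P\<close> at \<open>x\<close>.\<close>
      have "c s = (P (x + s *\<^sub>R v + t *\<^sub>R w) - P x - A (x + s *\<^sub>R v + t *\<^sub>R w - x))
        - (P (x + s *\<^sub>R v) - P x - A (x + s *\<^sub>R v - x))"
        by (simp add: c_def linear_add[OF linA] linear_cmul[OF linA] linear_diff[OF linA])
      also have "norm \<dots> \<le> e * norm (x + s *\<^sub>R v + t *\<^sub>R w - x) + e * norm (x + s *\<^sub>R v - x)"
        using lt[OF s] by (intro order_trans[OF norm_triangle_ineq4] add_mono d1(2)) (auto simp: algebra_simps)
      also have "\<dots> = e * (norm (s *\<^sub>R v + t *\<^sub>R w) + norm (s *\<^sub>R v))"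
        by (simp add: algebra_simps)
      also have "\<dots> \<le> e * (t * C)"
      proof (rule mult_left_mono)
        show "norm (s *\<^sub>R v + t *\<^sub>R w) + norm (s *\<^sub>R v) \<le> t * C"
          using nrm[OF s] t by (simp add: C_def algebra_simps)
      qed (use e in simp)
      also have "\<dots> = \<epsilon> * t" using C by (simp add: e_def)
      finally show "norm (h *\<^sub>R c s) \<le> \<epsilon> * t * norm h"
        using mult_right_mono[of "norm (c s)" "\<epsilon> * t" "norm h"] by (simp add: mult.commute)
    qed
    have "norm (\<phi> t - \<phi> 0) \<le> \<epsilon> * t * norm (t - 0)"
      by (rule differentiable_bound[OF _ der bnd]) (use t in auto)
    moreover have "\<phi> t - \<phi> 0 = f (x + t *\<^sub>R v + t *\<^sub>R w) - f (x + t *\<^sub>R v) - f (x + t *\<^sub>R w) + f x - t\<^sup>2 *\<^sub>R A w"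
      by (simp add: \<phi>_def power2_eq_square)
    ultimately show ?thesis using t by (simp add: power2_eq_square mult.assoc)
  qed
  with \<delta> show ?thesis by blast
qed

lemma second_derivative_symmetric:
  fixes f :: "'a::euclidean_space \<Rightarrow> 'b::real_normed_vector"
  assumes "open S" "x \<in> S" "Ck_on 2 S f"
  shows "frechet_derivative (\<lambda>y. frechet_derivative f (at y) v) (at x) w
    = frechet_derivative (\<lambda>y. frechet_derivative f (at y) w) (at x) v" (is "?A = ?B")
proof (rule ccontr)
  assume ne: "?A \<noteq> ?B"
  \<comment> \<open>A quarter suffices: the two bounds together leave a gap of at most 2 \<epsilon>,
    half of the assumed positive one.\<close>
  define \<epsilon> where "\<epsilon> = norm (?A - ?B) / 4"
  have \<epsilon>: "\<epsilon> > 0" using ne by (simp add: \<epsilon>_def)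
  obtain \<delta>1 where \<delta>1: "\<delta>1 > 0" "\<And>t. 0 < t \<Longrightarrow> t < \<delta>1 \<Longrightarrow>
    norm (f (x + t *\<^sub>R v + t *\<^sub>R w) - f (x + t *\<^sub>R v) - f (x + t *\<^sub>R w) + f x - t\<^sup>2 *\<^sub>R ?A) \<le> \<epsilon> * t\<^sup>2"
    using second_difference_bound[OF assms \<epsilon>, of v w] by blast
  obtain \<delta>2 where \<delta>2: "\<delta>2 > 0" "\<And>t. 0 < t \<Longrightarrow> t < \<delta>2 \<Longrightarrow>
    norm (f (x + t *\<^sub>R w + t *\<^sub>R v) - f (x + t *\<^sub>R w) - f (x + t *\<^sub>R v) + f x - t\<^sup>2 *\<^sub>R ?B) \<le> \<epsilon> * t\<^sup>2"
    using second_difference_bound[OF assms \<epsilon>, of w v] by blast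
  define t where "t = min \<delta>1 \<delta>2 / 2"
  have t: "0 < t" "t < \<delta>1" "t < \<delta>2" using \<delta>1 \<delta>2 by (auto simp: t_def)
  let ?X = "f (x + t *\<^sub>R v + t *\<^sub>R w) - f (x + t *\<^sub>R v) - f (x + t *\<^sub>R w) + f x"
  have "norm (?X - t\<^sup>2 *\<^sub>R ?A) \<le> \<epsilon> * t\<^sup>2" using \<delta>1(2) t by blast
  moreover have "norm (?X - t\<^sup>2 *\<^sub>R ?B) \<le> \<epsilon> * t\<^sup>2"
    using \<delta>2(2)[OF t(1,3)] by (simp add: algebra_simps)
  ultimately have "norm ((?X - t\<^sup>2 *\<^sub>R ?B) - (?X - t\<^sup>2 *\<^sub>R ?A)) \<le> 2 * \<epsilon> * t\<^sup>2"
    using norm_triangle_ineq4[of "?X - t\<^sup>2 *\<^sub>R ?B" "?X - t\<^sup>2 *\<^sub>R ?A"] by linarith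
  then have "norm (t\<^sup>2 *\<^sub>R (?A - ?B)) \<le> 2 * \<epsilon> * t\<^sup>2"
    by (simp add: algebra_simps)
  moreover have "norm (t\<^sup>2 *\<^sub>R (?A - ?B)) = t\<^sup>2 * norm (?A - ?B)"
    by (simp only: norm_scaleR) simp
  ultimately have "t\<^sup>2 * norm (?A - ?B) \<le> t\<^sup>2 * (2 * \<epsilon>)" by (simp add: algebra_simps)
  then have "norm (?A - ?B) \<le> 2 * \<epsilon>" using t by simp
  then show False using \<epsilon> by (simp add: \<epsilon>_def)
qed

text \<open>Differentiability of the partial derivatives at \<open>x\<close> bounds the variation of
  the derivative linearly in |y - x|; the mean value inequality along the segment supplies the
  second factor.\<close>

lemma taylor_remainder_bigo:
  fixes f :: "'a::euclidean_space \<Rightarrow> real"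
  assumes "open S" "x \<in> S" "Ck_on 2 S f"
  shows "(\<lambda>y. f y - f x - frechet_derivative f (at x) (y - x)) \<in> O[at x](\<lambda>y. norm (y - x) ^ 2)"
proof -
  have f: "Ck_on (Suc (Suc 0)) S f" using assms(3) by (simp add: numeral_2_eq_2)
  let ?P = "\<lambda>b y. frechet_derivative f (at y) b"
  have Df: "(f has_derivative frechet_derivative f (at y)) (at y)" if "y \<in> S" for y
    using Ck_on_has_derivative[OF f _ that] by simp
  have "\<exists>K. \<forall>\<^sub>F y in nhds x. norm (?P b y - ?P b x) \<le> K * norm (y - x)" for b
  proof -
    define A where "A = frechet_derivative (?P b) (at x)"
    have A: "(?P b has_derivative A) (at x)"
      unfolding A_def by (rule Ck_on_has_derivative[OF Ck_on_derivative[OF f] _ assms(2)]) simp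
    then have bl: "bounded_linear A" by (rule has_derivative_bounded_linear)
    obtain d where d: "d > 0" "\<And>y. norm (y - x) < d \<Longrightarrow> norm (?P b y - ?P b x - A (y - x)) \<le> 1 * norm (y - x)"
      using A zero_less_one unfolding has_derivative_at_alt by blast
    have "norm (?P b y - ?P b x) \<le> (1 + onorm A) * norm (y - x)" if "dist y x < d" for y
    proof -
      have "norm (?P b y - ?P b x) \<le> norm (?P b y - ?P b x - A (y - x)) + norm (A (y - x))"
        using norm_triangle_ineq[of "?P b y - ?P b x - A (y - x)" "A (y - x)"] by simp
      also have "\<dots> \<le> 1 * norm (y - x) + onorm A * norm (y - x)"
        using that by (intro add_mono d(2) onorm[OF bl]) (simp add: dist_norm)
      finally show ?thesis by (simp add: algebra_simps)
    qed
    then show ?thesis using d(1) unfolding eventually_nhds_metric by blast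
  qed
  then obtain K where K: "\<And>b. \<forall>\<^sub>F y in nhds x. norm (?P b y - ?P b x) \<le> K b * norm (y - x)"
    by metis
  have "\<forall>\<^sub>F y in nhds x. y \<in> S \<and> (\<forall>b\<in>Basis. norm (?P b y - ?P b x) \<le> K b * norm (y - x))"
    using K assms(1,2) by (auto intro!: eventually_conj eventually_nhds_in_open eventually_ball_finite)
  then obtain d where d: "d > 0" "\<And>y. dist y x < d \<Longrightarrow> y \<in> S"
    "\<And>y b. dist y x < d \<Longrightarrow> b \<in> Basis \<Longrightarrow> norm (?P b y - ?P b x) \<le> K b * norm (y - x)"
    unfolding eventually_nhds_metric by blast
  \<comment> \<open>Absolute values because each \<open>K b\<close> is merely some constant and may
    be negative; the sum over the basis turns coordinate bounds into an operator bound.\<close>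
  define M where "M = (\<Sum>b\<in>Basis. \<bar>K b\<bar>)"
  have on: "onorm (frechet_derivative f (at y) - frechet_derivative f (at x)) \<le> M * norm (y - x)"
    if "dist y x < d" for y
  proof (rule onorm_le)
    fix h
    have "linear (\<lambda>h. frechet_derivative f (at y) h - frechet_derivative f (at x) h)"
      using Df[OF d(2)[OF that]] Df[OF assms(2)] by (intro linear_compose_sub has_derivative_linear)
    from linear_euclidean_sum[OF this, of h]
    have "norm ((frechet_derivative f (at y) - frechet_derivative f (at x)) h)
      = norm (\<Sum>b\<in>Basis. (h \<bullet> b) *\<^sub>R (?P b y - ?P b x))"
      by simp
    also have "\<dots> \<le> (\<Sum>b\<in>Basis. norm h * (\<bar>K b\<bar> * norm (y - x)))"
    proof (rule sum_norm_le)
      fix b :: 'a assume b: "b \<in> Basis"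
      have "norm (?P b y - ?P b x) \<le> \<bar>K b\<bar> * norm (y - x)"
        by (rule order_trans[OF d(3)[OF that b]]) (simp add: mult_right_mono)
      then show "norm ((h \<bullet> b) *\<^sub>R (?P b y - ?P b x)) \<le> norm h * (\<bar>K b\<bar> * norm (y - x))"
        using Basis_le_norm[OF b, of h] unfolding norm_scaleR by (intro mult_mono) auto
    qed
    also have "\<dots> = M * norm (y - x) * norm h"
      by (simp add: M_def sum_distrib_left sum_distrib_right mult_ac)
    finally show "norm ((frechet_derivative f (at y) - frechet_derivative f (at x)) h) \<le> M * norm (y - x) * norm h" .
  qed
  have "norm (f y - f x - frechet_derivative f (at x) (y - x)) \<le> M * norm (norm (y - x) ^ 2)"
    if y: "dist y x < d" for y
  proof -
    have seg: "dist z x < d \<and> norm (z - x) \<le> norm (y - x)" if "z \<in> closed_segment x y" for z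
      using segment_bound1[OF that] y by (simp add: dist_norm)
    have M: "M \<ge> 0" by (simp add: M_def sum_nonneg)
    have "norm (f y - f x - frechet_derivative f (at x) (y - x)) \<le> norm (y - x) * (M * norm (y - x))"
    proof (rule differentiable_bound_linearization)
      show "x + t *\<^sub>R (y - x) \<in> closed_segment x y" if "t \<in> {0..1}" for t
        using that unfolding closed_segment_def by (auto intro!: exI[of _ t] simp: algebra_simps)
      show "(f has_derivative frechet_derivative f (at z)) (at z within closed_segment x y)"
        if "z \<in> closed_segment x y" for z
        using Df d(2) seg[OF that] by (blast intro: has_derivative_at_withinI)
      show "onorm (frechet_derivative f (at z) - frechet_derivative f (at x)) \<le> M * norm (y - x)"
        if "z \<in> closed_segment x y" for z
        using on[of z] seg[OF that] mult_left_mono[OF _ M, of "norm (z - x)" "norm (y - x)"] by linarith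
    qed simp
    then show ?thesis by (simp add: power2_eq_square mult_ac)
  qed
  then show ?thesis
    using d(1) by (intro bigoI[of _ M]) (auto simp: eventually_at)
qed

section \<open>Inverse and implicit function theorems\<close>

lemma local_inverse:
  fixes f :: "'a::euclidean_space \<Rightarrow> 'a"
  assumes "open S" "x \<in> S" "Ck_on (Suc n) S f" "inj (frechet_derivative f (at x))"
  obtains U V g where "open U" "U \<subseteq> S" "x \<in> U" "open V" "f x \<in> V" "homeomorphism U V f g"
    "\<And>y. y \<in> V \<Longrightarrow> g differentiable (at y)"
proof -
  let ?D = "\<lambda>x. frechet_derivative f (at x)"
  have D: "(f has_derivative ?D x) (at x)" if "x \<in> S" for x
    using Ck_on_has_derivative[OF assms(3) _ that] by simp
  have bl: "blinfun_apply (Blinfun (?D x)) = ?D x" if "x \<in> S" for x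
    using D[OF that] by (simp add: bounded_linear_Blinfun_apply has_derivative_bounded_linear)
  \<comment> \<open>In finite dimension an injective endomorphism is invertible, so a left inverse
    already serves as the inverse of the derivative.\<close>
  obtain g' where g': "linear g'" "g' \<circ> ?D x = id"
    using linear_injective_left_inverse[OF has_derivative_linear[OF D[OF assms(2)]] assms(4)] by blast
  have inv: "Blinfun g' o\<^sub>L Blinfun (?D x) = id_blinfun"
    using g' bl[OF assms(2)]
    by (intro blinfun_eqI) (auto simp: bounded_linear_Blinfun_apply linear_conv_bounded_linear fun_eq_iff)
  show ?thesis
  proof (rule inverse_function_theorem[OF assms(1) _ continuous_on_Blinfun_derivative[OF assms(3)] assms(2) inv])
    show "(f has_derivative blinfun_apply (Blinfun (?D x))) (at x)" if "x \<in> S" for x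
      using D[OF that] bl[OF that] by simp
  next
    fix U V g gd
    assume "open U" "U \<subseteq> S" "x \<in> U" "open V" "f x \<in> V" "homeomorphism U V f g"
      and "\<And>y. y \<in> V \<Longrightarrow> (g has_derivative gd y) (at y)"
    then show thesis using that[of U V g] unfolding differentiable_def by blast
  qed
qed

text \<open>The local inverse of the map (q, second coordinate) contains the branch. That inverse is
  only known to be differentiable; the remaining smoothness comes from the formula for the slope of
  the branch.\<close>

lemma implicit_function_real:
  fixes q :: "real \<times> real \<Rightarrow> real"
  assumes S: "open S" "(a0, m0) \<in> S" and q: "Ck_on (Suc n) S q" "q (a0, m0) = 0"
    and nz: "frechet_derivative q (at (a0, m0)) (1, 0) \<noteq> 0"
  obtains \<epsilon> \<alpha> where "\<epsilon> > 0" "Ck_on (Suc n) {m0 - \<epsilon><..<m0 + \<epsilon>} \<alpha>" "\<alpha> m0 = a0"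
    "\<And>\<mu>. \<mu> \<in> {m0 - \<epsilon><..<m0 + \<epsilon>} \<Longrightarrow> (\<alpha> \<mu>, \<mu>) \<in> S \<and> q (\<alpha> \<mu>, \<mu>) = 0"
    "(\<alpha> has_real_derivative
      - (frechet_derivative q (at (a0, m0)) (0, 1) / frechet_derivative q (at (a0, m0)) (1, 0))) (at m0)"
proof -
  let ?D = "\<lambda>p. frechet_derivative q (at p)"
  \<comment> \<open>Restricting to points with nonzero first partial derivative makes the quotient
    formula for the slope valid along the whole branch.\<close>
  define T where "T = S \<inter> (\<lambda>p. ?D p (1, 0)) -` (- {0})"
  have D: "(q has_derivative ?D p) (at p)" if "p \<in> S" for p
    using Ck_on_has_derivative[OF q(1) _ that] by simp
  have lin: "?D p (h, k) = h * ?D p (1, 0) + k * ?D p (0, 1)" if "p \<in> S" for p h k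
  proof -
    have l: "linear (?D p)" using has_derivative_linear[OF D[OF that]] .
    have "?D p (h *\<^sub>R (1, 0) + k *\<^sub>R (0, 1)) = h * ?D p (1, 0) + k * ?D p (0, 1)"
      unfolding linear_add[OF l] linear_cmul[OF l] by simp
    then show ?thesis by simp
  qed
  have T: "open T"
    unfolding T_def using Ck_on_imp_continuous_on[OF Ck_on_derivative[OF q(1)]] S(1)
    by (intro continuous_open_preimage) auto
  have TS: "T \<subseteq> S" "(a0, m0) \<in> T" using nz S by (auto simp: T_def)
  define f where "f p = (q p, snd p)" for p
  have f: "Ck_on (Suc n) T f"
    unfolding f_def by (rule Ck_on_Pair[OF T Ck_on_subset[OF q(1) TS(1)] Ck_on_snd])
  have fD: "(f has_derivative (\<lambda>v. (?D p v, snd v))) (at p)" if "p \<in> S" for p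
    unfolding f_def using D[OF that] by (auto intro!: derivative_eq_intros)
  have "inj (frechet_derivative f (at (a0, m0)))"
  proof -
    have "frechet_derivative f (at (a0, m0)) = (\<lambda>v. (?D (a0, m0) v, snd v))"
      using frechet_derivative_at[OF fD[OF S(2)]] by simp
    moreover have "v = v'" if "?D (a0, m0) v = ?D (a0, m0) v'" "snd v = snd v'" for v v'
    proof -
      have "?D (a0, m0) u = fst u * ?D (a0, m0) (1, 0) + snd u * ?D (a0, m0) (0, 1)" for u
        using lin[OF S(2), of "fst u" "snd u"] by (simp only: prod.collapse)
      from this[of v] this[of v'] have "fst v * ?D (a0, m0) (1, 0) = fst v' * ?D (a0, m0) (1, 0)"
        by (metis add_right_cancel that)
      then show ?thesis using nz that(2) by (simp add: prod_eq_iff)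
    qed
    ultimately show ?thesis by (simp add: inj_def)
  qed
  then obtain U V g where UV: "open U" "U \<subseteq> T" "(a0, m0) \<in> U" "open V" "f (a0, m0) \<in> V"
    "homeomorphism U V f g" "\<And>y. y \<in> V \<Longrightarrow> g differentiable (at y)"
    using local_inverse[OF T TS(2) f] by metis
  have "open ((\<lambda>\<mu>. (0, \<mu>)) -` V)"
    using UV(4) by (intro open_vimage continuous_intros)
  moreover have "m0 \<in> (\<lambda>\<mu>. (0, \<mu>)) -` V" using UV(5) q(2) by (simp add: f_def)
  ultimately obtain \<epsilon> where \<epsilon>: "\<epsilon> > 0" "ball m0 \<epsilon> \<subseteq> (\<lambda>\<mu>. (0, \<mu>)) -` V"
    using open_contains_ball by blast
  let ?J = "{m0 - \<epsilon><..<m0 + \<epsilon>}"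
  have J: "open ?J" "m0 \<in> ?J" using \<epsilon> by auto
  have JV: "(0, \<mu>) \<in> V" if "\<mu> \<in> ?J" for \<mu>
    using \<epsilon>(2) that by (auto simp: ball_eq_greaterThanLessThan)
  define \<alpha> where "\<alpha> \<mu> = fst (g (0, \<mu>))" for \<mu>
  have g: "g (0, \<mu>) = (\<alpha> \<mu>, \<mu>)" "(\<alpha> \<mu>, \<mu>) \<in> T" "q (\<alpha> \<mu>, \<mu>) = 0" if "\<mu> \<in> ?J" for \<mu>
  proof -
    have "f (g (0, \<mu>)) = (0, \<mu>)" "g (0, \<mu>) \<in> U"
      using UV(6) JV[OF that] by (auto simp: homeomorphism_def)
    moreover from this show "g (0, \<mu>) = (\<alpha> \<mu>, \<mu>)"
      by (simp add: f_def \<alpha>_def prod_eq_iff)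
    ultimately show "(\<alpha> \<mu>, \<mu>) \<in> T" "q (\<alpha> \<mu>, \<mu>) = 0"
      using UV(2) by (auto simp: f_def)
  qed
  have a0: "\<alpha> m0 = a0"
  proof -
    have "g (f (a0, m0)) = (a0, m0)" using UV(3,6) by (auto simp: homeomorphism_def)
    then show ?thesis using q(2) by (simp add: f_def \<alpha>_def)
  qed
  define d where "d \<mu> = - (?D (\<alpha> \<mu>, \<mu>) (0, 1) * inverse (?D (\<alpha> \<mu>, \<mu>) (1, 0)))" for \<mu>
  have der: "(\<alpha> has_real_derivative d \<mu>) (at \<mu>)" if \<mu>: "\<mu> \<in> ?J" for \<mu>
  proof -
    have "(\<lambda>\<mu>. g (0, \<mu>)) differentiable (at \<mu>)"
      by (rule differentiable_compose[of g "\<lambda>\<mu>. (0, \<mu>)", OF UV(7)[OF JV[OF \<mu>]]]) simp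
    then have "\<alpha> differentiable (at \<mu>)"
      unfolding \<alpha>_def
      by (rule differentiable_compose[of fst, OF bounded_linear_imp_differentiable[OF bounded_linear_fst]])
    then obtain a' where a': "(\<alpha> has_real_derivative a') (at \<mu>)"
      by (auto simp: real_differentiable_def)
    have "((\<lambda>\<mu>. q (\<alpha> \<mu>, \<mu>)) has_derivative (\<lambda>h. ?D (\<alpha> \<mu>, \<mu>) (a' * h, h))) (at \<mu>)"
      using a' TS(1) g(2)[OF \<mu>]
      by (intro has_derivative_compose[OF _ D]) (auto intro!: derivative_eq_intros simp: has_field_derivative_def)
    moreover have "((\<lambda>\<mu>. q (\<alpha> \<mu>, \<mu>)) has_derivative (\<lambda>h. 0)) (at \<mu>)"
      by (rule has_derivative_transform_within_open[OF has_derivative_const J(1) \<mu>]) (use g(3) in auto)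
    ultimately have "(\<lambda>h. ?D (\<alpha> \<mu>, \<mu>) (a' * h, h)) = (\<lambda>h. 0)"
      by (rule has_derivative_unique)
    then have "?D (\<alpha> \<mu>, \<mu>) (a' * 1, 1) = 0" by meson
    then have "a' * ?D (\<alpha> \<mu>, \<mu>) (1, 0) + ?D (\<alpha> \<mu>, \<mu>) (0, 1) = 0"
      using lin[of "(\<alpha> \<mu>, \<mu>)" "a' * 1" 1] TS(1) g(2)[OF \<mu>] by auto
    moreover have "?D (\<alpha> \<mu>, \<mu>) (1, 0) \<noteq> 0" using g(2)[OF \<mu>] by (auto simp: T_def)
    ultimately have "a' = d \<mu>" by (simp add: d_def field_simps)
    then show ?thesis using a' by simp
  qed
  \<comment> \<open>Bootstrap: the slope is built from derivatives of \<open>q\<close> along the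
    branch, so it is as smooth as \<alpha> up to order n, and \<alpha> gains one order each
    time.\<close>
  have "Ck_on j ?J \<alpha>" if "j \<le> Suc n" for j
    using that
  proof (induction j)
    case 0
    have "isCont \<alpha> \<mu>" if "\<mu> \<in> ?J" for \<mu>
      using DERIV_isCont[OF der[OF that]] .
    then show ?case by (simp add: continuous_at_imp_continuous_on)
  next
    case (Suc j)
    have c: "Ck_on j ?J (\<lambda>\<mu>. ?D (\<alpha> \<mu>, \<mu>) v)" for v
    proof (rule Ck_on_compose[OF J(1), where g = "\<lambda>\<mu>. (\<alpha> \<mu>, \<mu>)" and f = "\<lambda>p. ?D p v" and T = S])
      show "Ck_on j ?J (\<lambda>\<mu>. (\<alpha> \<mu>, \<mu>))"
        using Suc by (intro Ck_on_Pair[OF J(1)] Ck_on_ident) auto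
      show "(\<lambda>\<mu>. (\<alpha> \<mu>, \<mu>)) ` ?J \<subseteq> S" using g(2) TS(1) by auto
      show "Ck_on j S (\<lambda>p. ?D p v)"
        by (rule Ck_on_le[OF Ck_on_derivative[OF q(1)]]) (use Suc.prems in simp)
    qed
    have "Ck_on j ?J (\<lambda>\<mu>. -1 * (?D (\<alpha> \<mu>, \<mu>) (0, 1) * inverse (?D (\<alpha> \<mu>, \<mu>) (1, 0))))"
      by (intro Ck_on_mult[OF J(1)] Ck_on_const Ck_on_inverse[OF J(1)] c)
        (use g(2) in \<open>auto simp: T_def\<close>)
    then have d: "Ck_on j ?J d" by (simp add: d_def[abs_def])
    show ?case
    proof (rule Ck_on_SucI[OF J(1)])
      show "(\<alpha> has_derivative (*) (d \<mu>)) (at \<mu>)" if "\<mu> \<in> ?J" for \<mu>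
        using der[OF that] by (simp add: has_field_derivative_def)
      show "Ck_on j ?J (\<lambda>\<mu>. d \<mu> * v)" for v
        by (intro Ck_on_mult[OF J(1)] d Ck_on_const)
    qed
  qed
  moreover have "(\<alpha> has_real_derivative - (?D (a0, m0) (0, 1) / ?D (a0, m0) (1, 0))) (at m0)"
    using der[OF J(2)] a0 by (simp add: d_def field_simps)
  ultimately show thesis
    using that[of \<epsilon> \<alpha>] \<epsilon>(1) a0 g(2,3) TS(1) by blast
qed

section \<open>Transcritical bifurcation of a scalar equation\<close>

lemma has_derivative_Pair_compose:
  assumes "(G has_derivative G') (at (a, b))"
  shows "((\<lambda>x. G (x, b)) has_derivative (\<lambda>h. G' (h, 0))) (at a)"
    and "((\<lambda>y. G (a, y)) has_derivative (\<lambda>h. G' (0, h))) (at b)"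
  by (rule has_derivative_compose[of "\<lambda>x. (x, b)" "\<lambda>h. (h, 0)" a UNIV G, OF _ assms]
      has_derivative_compose[of "\<lambda>y. (a, y)" "\<lambda>h. (0, h)" b UNIV G, OF _ assms],
      auto intro!: derivative_eq_intros)+

lemma has_field_derivative_Pair_compose:
  fixes G :: "real \<times> real \<Rightarrow> real"
  assumes "(G has_derivative G') (at (a, b))"
  shows "((\<lambda>x. G (x, b)) has_real_derivative G' (1, 0)) (at a)"
    and "((\<lambda>y. G (a, y)) has_real_derivative G' (0, 1)) (at b)"
proof -
  have l: "linear G'" using assms by (rule has_derivative_linear)
  have e: "G' (h, 0) = G' (1, 0) * h" "G' (0, h) = G' (0, 1) * h" for h
    using linear_cmul[OF l, of h "(1, 0)"] linear_cmul[OF l, of h "(0, 1)"]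
    by (simp_all only: scaleR_Pair scaleR_zero_right real_scaleR_def mult_1_right mult_zero_right mult.commute[of h])
  have "(\<lambda>h. G' (h, 0)) = (*) (G' (1, 0))" by (rule ext) (rule e)
  moreover have "(\<lambda>h. G' (0, h)) = (*) (G' (0, 1))" by (rule ext) (rule e)
  ultimately show "((\<lambda>x. G (x, b)) has_real_derivative G' (1, 0)) (at a)"
    "((\<lambda>y. G (a, y)) has_real_derivative G' (0, 1)) (at b)"
    using has_derivative_Pair_compose[OF assms] by (simp_all only: has_field_derivative_def)
qed

text \<open>The quotient averages the a-derivative of \<open>G\<close> over a horizontal segment,
  which costs one order of smoothness. On a = 0 that segment is a point, hence the values
  there.\<close>

lemma hadamard_factor:
  fixes G :: "real \<times> real \<Rightarrow> real"
  assumes "open V" "(0, 0) \<in> V" "Ck_on (Suc n) V G" "\<And>\<mu>. (0, \<mu>) \<in> V \<Longrightarrow> G (0, \<mu>) = 0"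
  obtains r q where "r > 0" "ball (0, 0) r \<subseteq> V" "Ck_on n (ball (0, 0) r) q"
    "\<And>p. p \<in> ball (0, 0) r \<Longrightarrow> G p = fst p * q p"
    "\<And>\<mu>. q (0, \<mu>) = frechet_derivative G (at (0, \<mu>)) (1, 0)"
proof -
  obtain R where R: "R > 0" "ball (0, 0) R \<subseteq> V"
    using assms(1,2) open_contains_ball by blast
  \<comment> \<open>Half the radius, because the integrand must be smooth for t in an open interval
    around [0, 1]: with |t| < 2 the point (t a, \<mu>) has norm at most 2 |p|.\<close>
  define r where "r = R / 2"
  let ?B = "ball (0, 0) r :: (real \<times> real) set"
  define D where "D p = frechet_derivative G (at p) (1, 0)" for p
  define q where "q p = integral {0..1} (\<lambda>t. D (t * fst p, snd p))" for p
  have mem: "(t * fst p, snd p) \<in> V" if "p \<in> ?B" "\<bar>t\<bar> < 2" for p t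
  proof -
    have "(t * fst p)\<^sup>2 \<le> 4 * (fst p)\<^sup>2"
      using power_mono[of "\<bar>t\<bar>" 2 2] that(2) by (simp add: power_mult_distrib mult_right_mono)
    then have "norm (t * fst p, snd p) \<le> sqrt (2\<^sup>2 * ((fst p)\<^sup>2 + (snd p)\<^sup>2))"
      by (simp add: norm_Pair power2_eq_square[of 2] add_increasing)
    also have "\<dots> = 2 * norm p"
      unfolding real_sqrt_mult norm_prod_def by simp
    also have "\<dots> < R" using that(1) by (simp add: r_def zero_prod_def[symmetric])
    finally show ?thesis using R(2) by (auto simp: zero_prod_def[symmetric])
  qed
  have Dk: "Ck_on n V D"
    unfolding D_def by (rule Ck_on_derivative[OF assms(3)])
  have "Ck_on n (?B \<times> {-2<..<2}) (\<lambda>z. D (snd z * fst (fst z), snd (fst z)))"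
  proof (rule Ck_on_compose[OF _ _ _ Dk])
    have o: "open (?B \<times> {-2<..<2::real})" by (intro open_Times) auto
    then show "open (?B \<times> {-2<..<2::real})" .
    have l: "bounded_linear (\<lambda>z::(real \<times> real) \<times> real. fst (fst z))"
      "bounded_linear (\<lambda>z::(real \<times> real) \<times> real. snd (fst z))"
      by (intro bounded_linear_fst_comp bounded_linear_snd_comp bounded_linear_fst)+
    show "Ck_on n (?B \<times> {-2<..<2}) (\<lambda>z. (snd z * fst (fst z), snd (fst z)))"
      by (intro Ck_on_Pair[OF o] Ck_on_mult[OF o] Ck_on_snd Ck_on_bounded_linear l)
    show "(\<lambda>z. (snd z * fst (fst z), snd (fst z))) ` (?B \<times> {-2<..<2}) \<subseteq> V"
      using mem by fastforce
  qed
  then have "Ck_on n ?B (\<lambda>p. integral {0..1} (\<lambda>t. D (snd (p, t) * fst (fst (p, t)), snd (fst (p, t)))))"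
    by (rule Ck_on_integral[rotated -1]) auto
  then have q: "Ck_on n ?B q"
    by (simp add: q_def[abs_def])
  have GD: "(G has_derivative frechet_derivative G (at p)) (at p)" if "p \<in> V" for p
    using Ck_on_has_derivative[OF assms(3) _ that] by simp
  have "G p = fst p * q p" if p: "p \<in> ?B" for p
  proof -
    have "((\<lambda>t. D (t * fst p, snd p) * fst p) has_integral G (1 * fst p, snd p) - G (0 * fst p, snd p)) {0..1}"
    proof (rule fundamental_theorem_of_calculus)
      fix t :: real assume "t \<in> {0..1}"
      then have m: "(t * fst p, snd p) \<in> V" using mem[OF p] by simp
      have "((\<lambda>t. G (t * fst p, snd p)) has_real_derivative D (t * fst p, snd p) * fst p) (at t)"
        unfolding D_def
        by (rule DERIV_chain2[of "\<lambda>x. G (x, snd p)" _ "\<lambda>t. t * fst p", OF has_field_derivative_Pair_compose(1)[OF GD[OF m]]])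
          (auto intro!: derivative_eq_intros)
      then show "((\<lambda>t. G (t * fst p, snd p)) has_vector_derivative D (t * fst p, snd p) * fst p)
          (at t within {0..1})"
        using has_real_derivative_iff_has_vector_derivative has_vector_derivative_at_within by blast
    qed simp
    then have "q p * fst p = G (1 * fst p, snd p) - G (0 * fst p, snd p)"
      unfolding q_def by (metis integral_mult_left integral_unique)
    moreover have "G (0 * fst p, snd p) = 0"
      using assms(4) mem[OF p, of 0] by simp
    ultimately show ?thesis by (simp add: mult.commute)
  qed
  moreover have "q (0, \<mu>) = frechet_derivative G (at (0, \<mu>)) (1, 0)" for \<mu>
    by (simp add: q_def D_def)
  moreover have "?B \<subseteq> V"
    using R by (auto simp: r_def zero_prod_def[symmetric])
  ultimately show thesis
    using that[of r q] q R(1) by (simp add: r_def)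
qed

lemma fst_bigo_norm:
  "fst \<in> O[F](\<lambda>p. norm (p :: real \<times> real))"
proof (intro bigoI[of _ 1] always_eventually allI)
  show "norm (fst p) \<le> 1 * norm (norm p)" for p :: "real \<times> real"
    using norm_fst_le[of "fst p" "snd p"] by simp
qed

text \<open>The normal form keeps the smoothness of \<open>g\<close>; the branch has one order less
  because it solves q = 0 for the quotient q. The hypothesis \<open>ga\<close> makes q vanish at the
  origin.\<close>

lemma transcritical_bifurcation:
  fixes g :: "real \<Rightarrow> real \<Rightarrow> real"
  assumes "open V" "(0, 0) \<in> V" and g: "Ck_on (Suc (Suc (Suc n))) V (case_prod g)"
    and triv: "\<forall>\<^sub>F \<mu> in nhds 0. g 0 \<mu> = 0"
    and ga: "frechet_derivative (case_prod g) (at (0, 0)) (1, 0) = 0"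
    and nz: "d_amu g 0 0 \<noteq> 0" "d_aa g 0 0 \<noteq> 0"
  shows "\<exists>\<kappa>. \<kappa> \<noteq> 0 \<and> transcritical_form (Suc (Suc (Suc n))) V g \<kappa>"
    and "\<exists>\<epsilon>>0. \<exists>\<alpha>. Ck_on (Suc (Suc n)) {-\<epsilon><..<\<epsilon>} \<alpha> \<and> \<alpha> 0 = 0 \<and>
       (\<lambda>\<mu>. \<alpha> \<mu> - (- (2 * d_amu g 0 0 / d_aa g 0 0) * \<mu>)) \<in> O[at 0](\<lambda>\<mu>. \<mu> ^ 2) \<and>
       (\<forall>\<mu>\<in>{-\<epsilon><..<\<epsilon>}. (\<alpha> \<mu>, \<mu>) \<in> V \<and> g (\<alpha> \<mu>) \<mu> = 0)"
proof -
  obtain d where d: "d > 0" "\<And>\<mu>. \<bar>\<mu>\<bar> < d \<Longrightarrow> g 0 \<mu> = 0"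
    using triv by (auto simp: eventually_nhds_metric dist_norm)
  \<comment> \<open>Cutting down to |\<mu>| < d puts the trivial solution at every point of the
    slice a = 0, as \<open>hadamard_factor\<close> requires.\<close>
  define V' where "V' = V \<inter> {p. \<bar>snd p\<bar> < d}"
  have V': "open V'" "(0, 0) \<in> V'" "V' \<subseteq> V"
    using assms(1,2) d(1) by (auto simp: V'_def intro!: open_Int open_Collect_less continuous_intros)
  obtain r q where r: "r > 0" "ball (0, 0) r \<subseteq> V'" and q: "Ck_on (Suc (Suc n)) (ball (0, 0) r) q"
    and gq: "\<And>p. p \<in> ball (0, 0) r \<Longrightarrow> case_prod g p = fst p * q p"
    and q0: "\<And>\<mu>. q (0, \<mu>) = frechet_derivative (case_prod g) (at (0, \<mu>)) (1, 0)"
    by (rule hadamard_factor[OF V'(1,2) Ck_on_subset[OF g V'(3)]])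
      (use d(2) in \<open>auto simp: V'_def\<close>)
  let ?B = "ball (0, 0) r :: (real \<times> real) set"
  let ?D = "\<lambda>p. frechet_derivative q (at p)"
  have B: "open ?B" "(0, 0) \<in> ?B" using r(1) by auto
  have coord: "(0, s) \<in> ?B \<longleftrightarrow> \<bar>s\<bar> < r" "(s, 0) \<in> ?B \<longleftrightarrow> \<bar>s\<bar> < r" for s
    by (auto simp: dist_Pair_Pair)
  have qD: "(q has_derivative ?D p) (at p)" if "p \<in> ?B" for p
    using Ck_on_has_derivative[OF q _ that] by simp
  have near0: "\<forall>\<^sub>F s in nhds 0. \<bar>s\<bar> < r"
    using r(1) by (auto simp: eventually_nhds_metric dist_norm)
  have amu: "d_amu g 0 0 = ?D (0, 0) (0, 1)"
  proof -
    have "deriv (\<lambda>r. g r \<mu>) 0 = q (0, \<mu>)" if "\<bar>\<mu>\<bar> < r" for \<mu>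
    proof -
      have m: "(0, \<mu>) \<in> ?B" using coord that by simp
      have "(case_prod g has_derivative frechet_derivative (case_prod g) (at (0, \<mu>))) (at (0, \<mu>))"
        using m r(2) V'(3) by (intro Ck_on_has_derivative[OF g]) auto
      from has_field_derivative_Pair_compose(1)[OF this] show ?thesis
        using q0[of \<mu>] by (auto dest: DERIV_imp_deriv)
    qed
    then have "d_amu g 0 0 = deriv (\<lambda>\<mu>. q (0, \<mu>)) 0"
      unfolding d_amu_def by (intro deriv_cong_ev eventually_mono[OF near0]) auto
    then show ?thesis
      using has_field_derivative_Pair_compose(2)[OF qD[OF B(2)]] by (simp add: DERIV_imp_deriv)
  qed
  \<comment> \<open>On \<mu> = 0 the reduced function is s q(s, 0), and at 0 its second derivative
    is twice q_a. This is the origin of the factor 2 in the slope.\<close>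
  have aa: "d_aa g 0 0 = 2 * ?D (0, 0) (1, 0)"
  proof -
    have "deriv (\<lambda>r. g r 0) s = q (s, 0) + s * ?D (s, 0) (1, 0)" if s: "\<bar>s\<bar> < r" for s
    proof -
      have "\<forall>\<^sub>F x in nhds s. \<bar>x\<bar> < r"
        using eventually_nhds_in_open[of "{-r<..<r}" s] s by (auto simp: abs_less_iff elim: eventually_mono)
      then have "deriv (\<lambda>r. g r 0) s = deriv (\<lambda>x. x * q (x, 0)) s"
        using gq coord by (intro deriv_cong_ev) (auto elim!: eventually_mono)
      also have "\<dots> = q (s, 0) + s * ?D (s, 0) (1, 0)"
        using has_field_derivative_Pair_compose(1)[OF qD, of s 0] s coord
        by (intro DERIV_imp_deriv) (auto intro!: derivative_eq_intros)
      finally show ?thesis .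
    qed
    then have "d_aa g 0 0 = deriv (\<lambda>s. q (s, 0) + s * ?D (s, 0) (1, 0)) 0"
      unfolding d_aa_def by (intro deriv_cong_ev eventually_mono[OF near0]) auto
    also have "\<dots> = 2 * ?D (0, 0) (1, 0)"
    proof -
      \<comment> \<open>The product rule for s q_a(s, 0) asks for a derivative of q_a, whose value
        is then multiplied by s = 0.\<close>
      have "((\<lambda>p. ?D p (1, 0)) has_derivative frechet_derivative (\<lambda>p. ?D p (1, 0)) (at (0, 0))) (at (0, 0))"
        by (rule Ck_on_has_derivative[OF Ck_on_derivative[OF q] _ B(2)]) simp
      from has_field_derivative_Pair_compose(1)[OF this]
        has_field_derivative_Pair_compose(1)[OF qD[OF B(2)]]
      show ?thesis
        by (intro DERIV_imp_deriv) (auto intro!: derivative_eq_intros)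
    qed
    finally show ?thesis .
  qed
  have q00: "q (0, 0) = 0" using q0[of 0] ga by simp
  let ?b = "d_amu g 0 0" and ?c = "d_aa g 0 0"
  have lin: "?D (0, 0) p = ?b * snd p + ?c / 2 * fst p" for p
  proof -
    have l: "linear (?D (0, 0))" using has_derivative_linear[OF qD[OF B(2)]] .
    have "?D (0, 0) (fst p *\<^sub>R (1, 0) + snd p *\<^sub>R (0, 1)) = fst p * ?D (0, 0) (1, 0) + snd p * ?D (0, 0) (0, 1)"
      unfolding linear_add[OF l] linear_cmul[OF l] by simp
    then show ?thesis by (simp add: amu aa)
  qed
  have q2: "Ck_on 2 ?B q" by (rule Ck_on_le[OF q]) simp
  \<comment> \<open>Chosen so that the linear part b \<mu> + (c / 2) a of q equals b (\<mu> -
    \<kappa> a).\<close>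
  define \<kappa> where "\<kappa> = - ?c / (2 * ?b)"
  \<comment> \<open>Defined through \<open>g\<close> instead of the Taylor remainder of q, so that
    it keeps the full smoothness of \<open>g\<close>; the estimate below rewrites it through
    q.\<close>
  define h where "h p = case_prod g p / ?b - fst p * (snd p - \<kappa> * fst p)" for p
  have "bifurcation_coordinates ?B (\<lambda>p. p)"
    unfolding bifurcation_coordinates_def smooth_on_def
    using B bij_id by (auto simp: Ck_on_ident frechet_derivative_ident id_def intro!: exI[of _ "\<lambda>x. x"])
  moreover have "(\<lambda>p. p) ` ?B \<subseteq> V" using r(2) V'(3) by auto
  moreover have "Ck_on (Suc (Suc (Suc n))) ?B h"
  proof -
    have "Ck_on (Suc (Suc (Suc n))) ?B (case_prod g)"
      by (rule Ck_on_subset[OF g]) (use r(2) V'(3) in auto)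
    then have "Ck_on (Suc (Suc (Suc n))) ?B (\<lambda>p. case_prod g p * (1 / ?b) - fst p * (snd p - \<kappa> * fst p))"
      using B(1) by (intro Ck_on_diff Ck_on_mult Ck_on_const Ck_on_fst Ck_on_snd)
    then show ?thesis by (simp add: h_def[abs_def] del: Ck_on.simps)
  qed
  moreover have "h \<in> O[at (0, 0)](\<lambda>p. norm p ^ 3)"
  proof -
    have "(\<lambda>p. q p - q (0, 0) - ?D (0, 0) (p - (0, 0))) \<in> O[at (0, 0)](\<lambda>p. norm (p - (0, 0)) ^ 2)"
      by (rule taylor_remainder_bigo[OF B q2])
    moreover have "p - (0, 0) = p" for p :: "real \<times> real" by (simp add: prod_eq_iff)
    ultimately have "(\<lambda>p. q p - (?b * snd p + ?c / 2 * fst p)) \<in> O[at (0, 0)](\<lambda>p. norm p ^ 2)"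
      by (simp add: lin q00)
    from landau_o.big.mult[OF fst_bigo_norm this]
    have "(\<lambda>p. fst p * (q p - (?b * snd p + ?c / 2 * fst p))) \<in> O[at (0, 0)](\<lambda>p. norm p * norm p ^ 2)" .
    then have "(\<lambda>p. (1 / ?b) * (fst p * (q p - (?b * snd p + ?c / 2 * fst p)))) \<in> O[at (0, 0)](\<lambda>p. norm p ^ 3)"
      using nz by (subst landau_o.big.cmult_in_iff) (simp_all add: power3_eq_cube power2_eq_square mult.assoc)
    moreover have "\<forall>\<^sub>F p in at (0, 0). h p = (1 / ?b) * (fst p * (q p - (?b * snd p + ?c / 2 * fst p)))"
    proof -
      have "\<forall>\<^sub>F p in at (0, 0). p \<in> ?B" by (rule eventually_at_in_open'[OF B])
      then show ?thesis
        by eventually_elim (use nz gq in \<open>simp add: h_def \<kappa>_def field_simps\<close>)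
    qed
    ultimately show ?thesis using landau_o.big.in_cong by fastforce
  qed
  moreover have "case_prod g (x, \<nu>) = ?b * (x * (\<nu> - \<kappa> * x) + h (x, \<nu>))" for x \<nu>
    using nz by (simp add: h_def)
  ultimately have "transcritical_form (Suc (Suc (Suc n))) V g \<kappa>"
    unfolding transcritical_form_def using nz
    by (intro exI[of _ ?B] exI[of _ "\<lambda>p. p"] exI[of _ "\<lambda>_. ?b"] exI[of _ h]) auto
  moreover have "\<kappa> \<noteq> 0" using nz by (simp add: \<kappa>_def)
  ultimately show "\<exists>\<kappa>. \<kappa> \<noteq> 0 \<and> transcritical_form (Suc (Suc (Suc n))) V g \<kappa>" by blast
  have "?D (0, 0) (1, 0) \<noteq> 0" using nz aa by simp
  then obtain \<epsilon> \<alpha> where \<epsilon>: "\<epsilon> > 0" and \<alpha>: "Ck_on (Suc (Suc n)) {0 - \<epsilon><..<0 + \<epsilon>} \<alpha>" "\<alpha> 0 = 0"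
    "\<And>\<mu>. \<mu> \<in> {0 - \<epsilon><..<0 + \<epsilon>} \<Longrightarrow> (\<alpha> \<mu>, \<mu>) \<in> ?B \<and> q (\<alpha> \<mu>, \<mu>) = 0"
    "(\<alpha> has_real_derivative - (?D (0, 0) (0, 1) / ?D (0, 0) (1, 0))) (at 0)"
    by (rule implicit_function_real[OF B q q00]) metis
  \<comment> \<open>The branch is at least C^2, so its own Taylor remainder is the required error
    term.\<close>
  have "(\<lambda>\<mu>. \<alpha> \<mu> - \<alpha> 0 - frechet_derivative \<alpha> (at 0) (\<mu> - 0)) \<in> O[at 0](\<lambda>\<mu>. norm (\<mu> - 0) ^ 2)"
    using \<epsilon> by (intro taylor_remainder_bigo[OF _ _ Ck_on_le[OF \<alpha>(1)]]) auto
  moreover have "frechet_derivative \<alpha> (at 0) = (*) (- (2 * ?b / ?c))"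
    using \<alpha>(4) frechet_derivative_at[of \<alpha> _ 0] by (simp add: has_field_derivative_def amu aa)
  ultimately have "(\<lambda>\<mu>. \<alpha> \<mu> - (- (2 * ?b / ?c) * \<mu>)) \<in> O[at 0](\<lambda>\<mu>. \<mu> ^ 2)"
    using \<alpha>(2) by simp
  moreover have "(\<alpha> \<mu>, \<mu>) \<in> V \<and> g (\<alpha> \<mu>) \<mu> = 0" if "\<mu> \<in> {-\<epsilon><..<\<epsilon>}" for \<mu>
    using \<alpha>(3)[of \<mu>] gq[of "(\<alpha> \<mu>, \<mu>)"] r(2) V'(3) that by auto
  ultimately show "\<exists>\<epsilon>>0. \<exists>\<alpha>. Ck_on (Suc (Suc n)) {-\<epsilon><..<\<epsilon>} \<alpha> \<and> \<alpha> 0 = 0 \<and>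
       (\<lambda>\<mu>. \<alpha> \<mu> - (- (2 * ?b / ?c) * \<mu>)) \<in> O[at 0](\<lambda>\<mu>. \<mu> ^ 2) \<and>
       (\<forall>\<mu>\<in>{-\<epsilon><..<\<epsilon>}. (\<alpha> \<mu>, \<mu>) \<in> V \<and> g (\<alpha> \<mu>) \<mu> = 0)"
    using \<epsilon> \<alpha>(1,2) by (intro exI[of _ \<epsilon>] conjI exI[of _ \<alpha>]) simp_all
qed

section \<open>Gradients and Hessians in straightened coordinates\<close>

lemma inner_coordinate_sum:
  fixes w :: "'e::euclidean_space" and \<phi> :: "'e \<Rightarrow> real"
  assumes "linear \<phi>"
  shows "(\<Sum>b\<in>Basis. \<phi> b *\<^sub>R b) \<bullet> w = \<phi> w"
proof -
  have "(\<Sum>b\<in>Basis. \<phi> b *\<^sub>R b) \<bullet> w = (\<Sum>b\<in>Basis. (w \<bullet> b) *\<^sub>R \<phi> b)"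
    unfolding inner_sum_left by (intro sum.cong) (simp_all add: inner_commute)
  then show ?thesis using linear_euclidean_sum[OF assms, of w] by simp
qed

text \<open>\<open>sharp\<close> is a definite description, so a representing vector must be shown
  to exist uniquely. Expressing \<open>B\<close> by the Euclidean inner product gives an
  endomorphism \<open>T\<close>, injective by positive definiteness and hence onto.\<close>

lemma sharp_eq_0_iff:
  fixes B :: "'e::euclidean_space \<Rightarrow> 'e \<Rightarrow> real"
  assumes B: "bilinear B" "\<And>v. v \<noteq> 0 \<Longrightarrow> B v v > 0" and \<phi>: "linear \<phi>"
  shows "sharp B \<phi> = 0 \<longleftrightarrow> (\<forall>w. \<phi> w = 0)"
proof -
  define T where "T x = (\<Sum>b\<in>Basis. B x b *\<^sub>R b)" for x
  have l: "linear (\<lambda>x. B x w)" "linear (B x)" for x w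
    using B(1) by (auto simp: bilinear_def)
  have T: "T x \<bullet> w = B x w" for x w
    unfolding T_def by (rule inner_coordinate_sum[OF l(2)])
  have linT: "linear T"
    unfolding T_def
    by (intro linearI) (simp_all add: linear_add[OF l(1)] linear_cmul[OF l(1)] scaleR_add_left
        sum.distrib scaleR_sum_right)
  have inj: "x = 0" if "\<And>w. B x w = 0" for x
    using B(2)[of x] that[of x] by fastforce
  have "inj T"
    unfolding linear_injective_0[OF linT]
  proof (intro allI impI)
    fix x assume "T x = 0"
    then have "B x w = 0" for w using T[of x w] by simp
    then show "x = 0" by (rule inj)
  qed
  with linT have "surj T" by (rule linear_inj_imp_surj)
  then obtain \<xi> where T\<xi>: "T \<xi> = (\<Sum>b\<in>Basis. \<phi> b *\<^sub>R b)" by (metis surjD)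
  have "B \<xi> w = \<phi> w" for w
    using T[of \<xi> w] inner_coordinate_sum[OF \<phi>, of w] T\<xi> by simp
  then have \<xi>: "\<forall>w. B \<xi> w = \<phi> w" ..
  have uniq: "\<xi>' = \<xi>" if "\<forall>w. B \<xi>' w = \<phi> w" for \<xi>'
    using inj[of "\<xi>' - \<xi>"] that \<xi> by (simp add: linear_diff[OF l(1)])
  have "sharp B \<phi> = \<xi>"
    unfolding sharp_def by (rule the_equality, rule \<xi>, rule uniq)
  moreover have "\<phi> w = 0" if "\<xi> = 0" for w
    using spec[OF \<xi>, of w] linear_0[OF l(1), of w] that by simp
  moreover have "\<xi> = 0" if "\<forall>w. \<phi> w = 0"
    using \<xi> that by (intro inj) simp
  ultimately show ?thesis by blast
qed

lemma grad_inner: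
  fixes f :: "'e::euclidean_space \<Rightarrow> real"
  assumes "(f has_derivative f') (at x)"
  shows "grad f x \<bullet> h = f' h"
proof -
  have lin: "linear f'" using assms by (rule has_derivative_linear)
  define D where "D = (\<Sum>b\<in>Basis. f' b *\<^sub>R b)"
  have D: "h \<bullet> D = f' h" for h
    unfolding D_def inner_commute[of h] by (rule inner_coordinate_sum[OF lin])
  then have "GDERIV f x :> D" using assms by (simp add: gderiv_def)
  moreover have "D' = D" if "GDERIV f x :> D'" for D'
  proof -
    have "(\<lambda>h. h \<bullet> D') = f'"
      using that assms has_derivative_unique unfolding gderiv_def by blast
    then have "h \<bullet> D' = h \<bullet> D" for h using D[of h] by metis
    then show ?thesis by (metis vector_eq_ldot)
  qed
  ultimately have "grad f x = D" unfolding grad_def by (rule the_equality)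
  then show ?thesis using D[of h] by (simp add: inner_commute)
qed

text \<open>Symmetry moves \<open>w\<close> from the inner to the outer differentiation, where
  linearity is that of a derivative.\<close>

lemma linear_second_derivative:
  fixes h :: "'a::euclidean_space \<Rightarrow> 'b::real_normed_vector"
  assumes "open S" "x \<in> S" "Ck_on 2 S h"
  shows "linear (\<lambda>w. frechet_derivative (\<lambda>y. frechet_derivative h (at y) w) (at x) v)"
proof -
  have "Ck_on (Suc (Suc 0)) S h" using assms(3) by (simp add: numeral_2_eq_2)
  from has_derivative_linear[OF Ck_on_has_derivative[OF Ck_on_derivative[OF this] _ assms(2)]]
  have "linear (frechet_derivative (\<lambda>y. frechet_derivative h (at y) v) (at x))" by simp
  moreover have "(\<lambda>w. frechet_derivative (\<lambda>y. frechet_derivative h (at y) w) (at x) v)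
    = frechet_derivative (\<lambda>y. frechet_derivative h (at y) v) (at x)"
    using second_derivative_symmetric[OF assms] by (intro ext)
  ultimately show ?thesis by simp
qed

text \<open>The chain rule yields an extra term, the second derivative of \<psi> fed into the
  derivative of \<open>h\<close>; it vanishes at a critical point. What remains is the pullback of a
  bilinear form.\<close>

lemma second_derivative_pullback_critical:
  fixes h :: "'b::euclidean_space \<Rightarrow> 'c::real_normed_vector" and \<psi> :: "'a::euclidean_space \<Rightarrow> 'b"
  assumes S: "open S" "x \<in> S" and T: "open T" "\<psi> ` S \<subseteq> T" and \<psi>: "Ck_on 2 S \<psi>" and h: "Ck_on 2 T h"
    and crit: "frechet_derivative h (at (\<psi> x)) = (\<lambda>_. 0)"
  shows "frechet_derivative (\<lambda>u. frechet_derivative (\<lambda>u. h (\<psi> u)) (at u) b) (at x) v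
    = frechet_derivative (\<lambda>y. frechet_derivative h (at y) (frechet_derivative \<psi> (at x) b)) (at (\<psi> x))
        (frechet_derivative \<psi> (at x) v)"
proof -
  let ?D = "\<lambda>f x. frechet_derivative f (at x)"
  have \<psi>2: "Ck_on (Suc (Suc 0)) S \<psi>" and h2: "Ck_on (Suc (Suc 0)) T h"
    using \<psi> h by (simp_all add: numeral_2_eq_2)
  have x: "\<psi> x \<in> T" using S T by auto
  have \<psi>D: "(\<psi> has_derivative ?D \<psi> u) (at u)" and hD: "(h has_derivative ?D h (\<psi> u)) (at (\<psi> u))"
    if "u \<in> S" for u
    using Ck_on_has_derivative[OF \<psi>2 _ that] Ck_on_has_derivative[OF h2, of "\<psi> u"] T that by auto
  \<comment> \<open>The direction in which \<open>h\<close> is differentiated moves with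
    \<open>u\<close>, so it is expanded in the basis before differentiating again.\<close>
  have first: "?D (\<lambda>u. h (\<psi> u)) u b = (\<Sum>i\<in>Basis. (?D \<psi> u b \<bullet> i) *\<^sub>R ?D h (\<psi> u) i)" if "u \<in> S" for u
  proof -
    have "((\<lambda>u. h (\<psi> u)) has_derivative (\<lambda>v. ?D h (\<psi> u) (?D \<psi> u v))) (at u)"
      by (rule has_derivative_compose[OF \<psi>D[OF that] hD[OF that]])
    from frechet_derivative_at[OF this, symmetric]
    show ?thesis
      by (simp only: linear_euclidean_sum[OF has_derivative_linear[OF hD[OF that]], symmetric])
  qed
  define P where "P i = (\<lambda>y. ?D h y i)" for i
  have P: "((\<lambda>u. P i (\<psi> u)) has_derivative (\<lambda>v. ?D (P i) (\<psi> x) (?D \<psi> x v))) (at x)" for i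
    unfolding P_def
    by (rule has_derivative_compose[OF \<psi>D[OF S(2)] Ck_on_has_derivative[OF Ck_on_derivative[OF h2] _ x]]) simp
  have Q: "((\<lambda>u. ?D \<psi> u b \<bullet> i) has_derivative (\<lambda>v. ?D (\<lambda>u. ?D \<psi> u b) x v \<bullet> i)) (at x)" for i
    by (rule has_derivative_inner_left[OF Ck_on_has_derivative[OF Ck_on_derivative[OF \<psi>2] _ S(2)]]) simp
  have "((\<lambda>u. \<Sum>i\<in>Basis. (?D \<psi> u b \<bullet> i) *\<^sub>R P i (\<psi> u)) has_derivative
      (\<lambda>v. \<Sum>i\<in>Basis. (?D \<psi> x b \<bullet> i) *\<^sub>R ?D (P i) (\<psi> x) (?D \<psi> x v)
        + (?D (\<lambda>u. ?D \<psi> u b) x v \<bullet> i) *\<^sub>R P i (\<psi> x))) (at x)"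
    by (intro has_derivative_sum has_derivative_scaleR P Q)
  then have "((\<lambda>u. ?D (\<lambda>u. h (\<psi> u)) u b) has_derivative
      (\<lambda>v. \<Sum>i\<in>Basis. (?D \<psi> x b \<bullet> i) *\<^sub>R ?D (P i) (\<psi> x) (?D \<psi> x v)
        + (?D (\<lambda>u. ?D \<psi> u b) x v \<bullet> i) *\<^sub>R P i (\<psi> x))) (at x)"
    by (rule has_derivative_transform_within_open[OF _ S]) (simp add: first P_def)
  from frechet_derivative_at[OF this, symmetric]
  have "?D (\<lambda>u. ?D (\<lambda>u. h (\<psi> u)) u b) x v
      = (\<Sum>i\<in>Basis. (?D \<psi> x b \<bullet> i) *\<^sub>R ?D (P i) (\<psi> x) (?D \<psi> x v))"
    by (simp add: P_def crit)
  also have "\<dots> = ?D (P (?D \<psi> x b)) (\<psi> x) (?D \<psi> x v)"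
    using linear_euclidean_sum[OF linear_second_derivative[OF T(1) x h], of "?D \<psi> x b" "?D \<psi> x v"]
    by (simp add: P_def)
  finally show ?thesis by (simp add: P_def)
qed

text \<open>The component of H u along \<open>v0\<close> is u . H v0 = 0 by symmetry. So P_R H u = 0
  already forces u into the kernel line, and u . v0 = 0 then leaves u = 0.\<close>

lemma range_equation_unique:
  fixes F :: "'e::euclidean_space \<Rightarrow> real \<Rightarrow> 'e"
  assumes W: "open W" "(0, 0) \<in> W" and F: "Ck_on 1 W (\<lambda>(u, \<mu>). F u \<mu>)"
    and sym: "\<And>v w. frechet_derivative (\<lambda>u. F u 0) (at 0) v \<bullet> w = v \<bullet> frechet_derivative (\<lambda>u. F u 0) (at 0) w"
    and ker: "{v. frechet_derivative (\<lambda>u. F u 0) (at 0) v = 0} = span {v0}" and v0: "norm v0 = 1"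
  obtains U where "open U" "(0, 0) \<in> U" "U \<subseteq> W"
    "\<And>u u' \<mu>. (u, \<mu>) \<in> U \<Longrightarrow> (u', \<mu>) \<in> U \<Longrightarrow> u \<bullet> v0 = u' \<bullet> v0 \<Longrightarrow>
      proj_R v0 (F u \<mu>) = proj_R v0 (F u' \<mu>) \<Longrightarrow> u = u'"
proof -
  define H where "H = frechet_derivative (\<lambda>u. F u 0) (at 0)"
  define Fp where "Fp = (\<lambda>(u, \<mu>). F u \<mu>)"
  define D where "D = frechet_derivative Fp (at (0, 0))"
  have F1: "Ck_on (Suc 0) W Fp" using F by (simp add: Fp_def)
  have D: "(Fp has_derivative D) (at (0, 0))"
    unfolding D_def by (rule Ck_on_has_derivative[OF F1 _ W(2)]) simp
  have DH: "D (v, 0) = H v" for v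
    using fun_cong[OF frechet_derivative_at[OF has_derivative_Pair_compose(1)[OF D]], of v]
    by (simp add: H_def Fp_def)
  have linR: "bounded_linear (proj_R v0)"
    unfolding proj_R_def[abs_def] proj_N_def
    by (intro bounded_linear_sub bounded_linear_ident bounded_linear_scaleR_left[THEN bounded_linear_compose]
        bounded_linear_inner_left)
  have linN: "bounded_linear (\<lambda>u. (u \<bullet> v0) *\<^sub>R v0)"
    by (intro bounded_linear_scaleR_left[THEN bounded_linear_compose] bounded_linear_inner_left)
  \<comment> \<open>Keeping the parameter as last coordinate gives one neighbourhood of uniqueness
    for all \<mu> at once.\<close>
  define f where "f p = (proj_R v0 (Fp p) + (fst p \<bullet> v0) *\<^sub>R v0, snd p)" for p
  have f: "Ck_on (Suc 0) W f"
    unfolding f_def using W(1) F1 linR linN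
    by (intro Ck_on_Pair Ck_on_add Ck_on_snd Ck_on_linear_compose[of _ "proj_R v0"]
        Ck_on_linear_compose[of _ "\<lambda>u. (u \<bullet> v0) *\<^sub>R v0"] Ck_on_fst)
  have "(f has_derivative (\<lambda>p. (proj_R v0 (D p) + (fst p \<bullet> v0) *\<^sub>R v0, snd p))) (at (0, 0))"
    unfolding f_def
    by (auto intro!: derivative_eq_intros bounded_linear.has_derivative[OF linR D])
  note fD = frechet_derivative_at[OF this, symmetric]
  have v1: "v0 \<bullet> v0 = 1" using v0 by (simp add: dot_square_norm)
  have R0: "proj_R v0 x \<bullet> v0 = 0" for x
    by (simp add: proj_R_def proj_N_def inner_diff_left v1)
  have Hv0: "H v0 = 0" using ker span_base[of v0 "{v0}"] by (auto simp: H_def)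
  have "inj (frechet_derivative f (at (0, 0)))"
  proof (subst linear_injective_0)
    show "linear (frechet_derivative f (at (0, 0)))"
      by (rule has_derivative_linear[OF Ck_on_has_derivative[OF f _ W(2)]]) simp
    show "\<forall>p. frechet_derivative f (at (0, 0)) p = 0 \<longrightarrow> p = 0"
    proof (intro allI impI)
      fix p :: "'e \<times> real"
      assume "frechet_derivative f (at (0, 0)) p = 0"
      then have s: "snd p = 0" and e: "proj_R v0 (D p) + (fst p \<bullet> v0) *\<^sub>R v0 = 0"
        by (simp_all add: fD zero_prod_def)
      have p: "p = (fst p, 0)" using s by (simp add: prod_eq_iff)
      have "(proj_R v0 (D p) + (fst p \<bullet> v0) *\<^sub>R v0) \<bullet> v0 = 0" using e by simp
      then have n: "fst p \<bullet> v0 = 0" by (simp add: inner_add_left R0 v1)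
      with e have "proj_R v0 (D p) = 0" by simp
      moreover have "D p = H (fst p)" using DH[of "fst p"] p by simp
      moreover have "H (fst p) \<bullet> v0 = 0" using sym[of "fst p" v0] Hv0 by (simp add: H_def)
      ultimately have "H (fst p) = 0" by (simp add: proj_R_def proj_N_def)
      then have "fst p \<in> span {v0}" using ker by (auto simp: H_def)
      then obtain c where "fst p = c *\<^sub>R v0" by (auto simp: span_singleton)
      with n v1 have "fst p = 0" by simp
      with s show "p = 0" by (simp add: prod_eq_iff)
    qed
  qed
  then obtain U V g where U: "open U" "U \<subseteq> W" "(0, 0) \<in> U" "homeomorphism U V f g"
    using local_inverse[OF W f] by metis
  have "u = u'" if "(u, \<mu>) \<in> U" "(u', \<mu>) \<in> U" "u \<bullet> v0 = u' \<bullet> v0"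
    "proj_R v0 (F u \<mu>) = proj_R v0 (F u' \<mu>)" for u u' \<mu>
  proof -
    have "f (u, \<mu>) = f (u', \<mu>)" using that by (simp add: f_def Fp_def)
    then have "g (f (u, \<mu>)) = g (f (u', \<mu>))" by simp
    then show ?thesis using U(4) that by (simp add: homeomorphism_def)
  qed
  then show thesis using that[of U] U by blast
qed

section \<open>The objective on the manifold read in straightened coordinates\<close>

locale straightened_problem =
  fixes A :: "('m::{t2_space,second_countable_topology}, 'e::euclidean_space) chart set"
    and G :: "('m, 'e) metric" and I :: "real set" and k :: nat
    and L :: "'m \<Rightarrow> real \<Rightarrow> real" and \<theta>0 :: "real \<Rightarrow> 'm" and ls :: real
    and W :: "('e \<times> real) set" and \<Phi> :: "'e \<times> real \<Rightarrow> 'm"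
  assumes atlas: "smooth_atlas A" and metric: "riemannian_metric A G" and I: "open I"
    and k: "k \<ge> 2" and Ck_L: "Ck_objective k A I L"
    and straight: "straightening A I \<theta>0 ls W \<Phi>"
begin

definition Lt :: "'e \<times> real \<Rightarrow> real" where
  "Lt p = L (\<Phi> p) (ls + snd p)"

abbreviation F :: "'e \<Rightarrow> real \<Rightarrow> 'e" where
  "F \<equiv> straightened_grad L ls \<Phi>"

abbreviation H :: "'e \<Rightarrow> 'e" where
  "H \<equiv> frechet_derivative (\<lambda>u. F u 0) (at 0)"

lemma W: "open W" "(0, 0) \<in> W"
  using straight by (auto simp: straightening_def)

lemma chart_cover: "\<exists>c\<in>A. \<theta> \<in> fst c"
  using atlas unfolding smooth_atlas_def by blast

lemma chart:
  assumes "c \<in> A"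
  shows "open (fst c)" "open (chart_image c)" "\<theta> \<in> fst c \<Longrightarrow> chart_inv c (snd c \<theta>) = \<theta>"
  using atlas assms by (auto simp: smooth_atlas_def homeomorphism_def)

lemma chart_preimage:
  assumes "c \<in> A"
  shows "open (W \<inter> \<Phi> -` fst c)" "Ck_on n (W \<inter> \<Phi> -` fst c) (\<lambda>p. snd c (\<Phi> p))"
proof -
  have s: "smooth_into A W \<Phi>" using straight by (simp add: straightening_def)
  then show "open (W \<inter> \<Phi> -` fst c)"
    using W(1) chart(1)[OF assms] by (auto simp: smooth_into_def intro: continuous_open_preimage)
  show "Ck_on n (W \<inter> \<Phi> -` fst c) (\<lambda>p. snd c (\<Phi> p))"
    using s assms by (auto simp: smooth_into_def smooth_on_def o_def)
qed

text \<open>The image of \<Phi> need not lie in one chart, so smoothness is checked locally.\<close>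

lemma Ck_Lt: "Ck_on k W Lt"
proof (rule Ck_on_local)
  fix p assume p: "p \<in> W"
  obtain c where c: "c \<in> A" "\<Phi> p \<in> fst c" using chart_cover by blast
  let ?T = "W \<inter> \<Phi> -` fst c"
  have T: "open ?T" by (rule chart_preimage[OF c(1)])
  have h: "Ck_on k (chart_image c \<times> I) (\<lambda>(x, l). L (chart_inv c x) l)"
    using Ck_L c(1) by (simp add: Ck_objective_def)
  have "Ck_on k ?T (\<lambda>p. (\<lambda>(x, l). L (chart_inv c x) l) (snd c (\<Phi> p), ls + snd p))"
  proof (rule Ck_on_compose[OF T _ _ h])
    show "Ck_on k ?T (\<lambda>p. (snd c (\<Phi> p), ls + snd p))"
      by (intro Ck_on_Pair[OF T] Ck_on_add[OF T] Ck_on_const Ck_on_snd chart_preimage(2) c)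
    show "(\<lambda>p. (snd c (\<Phi> p), ls + snd p)) ` ?T \<subseteq> chart_image c \<times> I"
      using straight by (auto simp: straightening_def)
  qed
  then have "Ck_on k ?T Lt"
    by (rule Ck_on_cong[OF T, rotated]) (use chart(3)[OF c(1)] in \<open>simp add: Lt_def\<close>)
  then show "\<exists>T. open T \<and> p \<in> T \<and> Ck_on k T Lt"
    using T p c(2) by blast
qed

lemma F_inner:
  assumes "(u, \<mu>) \<in> W"
  shows "F u \<mu> \<bullet> v = frechet_derivative Lt (at (u, \<mu>)) (v, 0)"
    and "F u \<mu> \<bullet> v = frechet_derivative (\<lambda>u. Lt (u, \<mu>)) (at u) v"
proof -
  have "(Lt has_derivative frechet_derivative Lt (at (u, \<mu>))) (at (u, \<mu>))"
    by (rule Ck_on_has_derivative[OF Ck_Lt _ assms]) (use k in simp)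
  from has_derivative_Pair_compose(1)[OF this]
  have D: "((\<lambda>u. Lt (u, \<mu>)) has_derivative (\<lambda>v. frechet_derivative Lt (at (u, \<mu>)) (v, 0))) (at u)" .
  show "F u \<mu> \<bullet> v = frechet_derivative Lt (at (u, \<mu>)) (v, 0)"
    unfolding straightened_grad_def straightened_objective_def
    using grad_inner[OF D] by (simp add: Lt_def)
  then show "F u \<mu> \<bullet> v = frechet_derivative (\<lambda>u. Lt (u, \<mu>)) (at u) v"
    using frechet_derivative_at[OF D] by metis
qed

lemma Ck_F: "Ck_on (k - 1) W (\<lambda>(u, \<mu>). F u \<mu>)"
proof -
  have "Ck_on (Suc (k - 1)) W Lt" using Ck_Lt k by simp
  then have "Ck_on (k - 1) W (\<lambda>p. \<Sum>b\<in>Basis. frechet_derivative Lt (at p) (b, 0) *\<^sub>R b)"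
    by (intro Ck_on_sum Ck_on_scaleR Ck_on_const W(1) Ck_on_derivative)
  then show ?thesis
  proof (rule Ck_on_cong[OF W(1), rotated])
    fix p assume "p \<in> W"
    then show "(\<Sum>b\<in>Basis. frechet_derivative Lt (at p) (b, 0) *\<^sub>R b) = (\<lambda>(u, \<mu>). F u \<mu>) p"
      using F_inner(1)[of "fst p" "snd p"] euclidean_representation[of "F (fst p) (snd p)"]
      by (simp add: case_prod_unfold)
  qed
qed

text \<open>With the parameter frozen, the straightened objective factors through a chart as
  \<open>h\<close> after \<psi>, with \<psi> a local coordinate change. All comparisons of
  derivatives on the two sides use this factorisation.\<close>

lemma parameter_slice:
  assumes "c \<in> A" "(u, \<mu>) \<in> W" "\<Phi> (u, \<mu>) \<in> fst c"
  defines "S \<equiv> {u. (u, \<mu>) \<in> W \<inter> \<Phi> -` fst c}"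
    and "\<psi> \<equiv> \<lambda>u. snd c (\<Phi> (u, \<mu>))" and "h \<equiv> \<lambda>x. L (chart_inv c x) (ls + \<mu>)"
  shows "open S" "u \<in> S" "\<psi> ` S \<subseteq> chart_image c" "Ck_on n S \<psi>" "Ck_on k (chart_image c) h"
    "\<And>u. u \<in> S \<Longrightarrow> h (\<psi> u) = Lt (u, \<mu>)" "bij (frechet_derivative \<psi> (at u))"
proof -
  have S: "S = (\<lambda>u. (u, \<mu>)) -` (W \<inter> \<Phi> -` fst c)" by (auto simp: S_def)
  show o: "open S"
    unfolding S by (intro open_vimage chart_preimage assms continuous_intros)
  show "u \<in> S" "\<psi> ` S \<subseteq> chart_image c" using assms(2,3) by (auto simp: S_def \<psi>_def)
  show "Ck_on n S \<psi>"
    unfolding \<psi>_def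
  proof (rule Ck_on_compose[where g = "\<lambda>u. (u, \<mu>)" and f = "\<lambda>p. snd c (\<Phi> p)", OF o _ _ chart_preimage(2)[OF assms(1)]])
    show "Ck_on n S (\<lambda>u. (u, \<mu>))" by (intro Ck_on_Pair[OF o] Ck_on_ident Ck_on_const)
  qed (auto simp: S_def)
  have I\<mu>: "ls + \<mu> \<in> I" using straight assms(2) by (auto simp: straightening_def)
  have L: "Ck_on k (chart_image c \<times> I) (\<lambda>(x, l). L (chart_inv c x) l)"
    using Ck_L assms(1) by (simp add: Ck_objective_def)
  have "Ck_on k (chart_image c) (\<lambda>x. (\<lambda>(x, l). L (chart_inv c x) l) (x, ls + \<mu>))"
  proof (rule Ck_on_compose[OF chart(2)[OF assms(1)] _ _ L])
    show "Ck_on k (chart_image c) (\<lambda>x. (x, ls + \<mu>))"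
      by (intro Ck_on_Pair chart assms Ck_on_ident Ck_on_const)
  qed (use I\<mu> in auto)
  then show "Ck_on k (chart_image c) h" by (simp add: h_def)
  show "h (\<psi> u) = Lt (u, \<mu>)" if "u \<in> S" for u
    using that chart(3)[OF assms(1)] by (simp add: h_def \<psi>_def Lt_def S_def)
  show "bij (frechet_derivative \<psi> (at u))"
    using straight assms(1-3) by (auto simp: straightening_def \<psi>_def)
qed

lemma sharp_metric_eq_0_iff:
  assumes "c \<in> A" "\<theta> \<in> fst c" "linear \<phi>"
  shows "sharp (G c (snd c \<theta>)) \<phi> = 0 \<longleftrightarrow> (\<forall>w. \<phi> w = 0)"
  using metric assms by (intro sharp_eq_0_iff) (auto simp: riemannian_metric_def)

text \<open>By the chain rule F pairs with v as the chart differential pairs with D\<psi> v, and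
  D\<psi> is onto.\<close>

lemma F_eq_0_iff_derivative:
  assumes "c \<in> A" "(u, \<mu>) \<in> W" "\<Phi> (u, \<mu>) \<in> fst c"
  shows "F u \<mu> = 0 \<longleftrightarrow>
    (\<forall>w. frechet_derivative (\<lambda>x. L (chart_inv c x) (ls + \<mu>)) (at (snd c (\<Phi> (u, \<mu>)))) w = 0)"
    (is "_ \<longleftrightarrow> (\<forall>w. ?h' w = 0)")
proof -
  note ps = parameter_slice[OF assms]
  let ?S = "{u. (u, \<mu>) \<in> W \<inter> \<Phi> -` fst c}"
  let ?\<psi> = "\<lambda>u. snd c (\<Phi> (u, \<mu>))"
  let ?\<psi>' = "frechet_derivative ?\<psi> (at u)"
  have "((\<lambda>x. L (chart_inv c x) (ls + \<mu>)) has_derivative ?h') (at (?\<psi> u))"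
    by (rule Ck_on_has_derivative[OF ps(5)]) (use k assms(3) in auto)
  then have "((\<lambda>u. L (chart_inv c (?\<psi> u)) (ls + \<mu>)) has_derivative (\<lambda>v. ?h' (?\<psi>' v))) (at u)"
    by (rule has_derivative_compose[OF Ck_on_has_derivative[OF ps(4)[of 1] _ ps(2)], rotated]) simp
  then have "((\<lambda>u. Lt (u, \<mu>)) has_derivative (\<lambda>v. ?h' (?\<psi>' v))) (at u)"
    by (rule has_derivative_transform_within_open[OF _ ps(1,2)]) (rule ps(6))
  then have e: "F u \<mu> \<bullet> v = ?h' (?\<psi>' v)" for v
    unfolding F_inner(2)[OF assms(2)] by (simp only: frechet_derivative_at[symmetric])
  show ?thesis
  proof
    assume "F u \<mu> = 0"
    then have "?h' (?\<psi>' v) = 0" for v using e[of v] by simp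
    then show "\<forall>w. ?h' w = 0" by (metis surjD[OF bij_is_surj[OF ps(7)]])
  next
    assume "\<forall>w. ?h' w = 0"
    then have "F u \<mu> \<bullet> F u \<mu> = 0" unfolding e[of "F u \<mu>"] by blast
    then show "F u \<mu> = 0" by simp
  qed
qed

text \<open>The two gradients come from different inner products, but each vanishes exactly when the
  same differential does.\<close>

lemma riem_grad_eq_0_iff:
  assumes "c \<in> A" "(u, \<mu>) \<in> W" "\<Phi> (u, \<mu>) \<in> fst c"
  shows "riem_grad G c (\<lambda>\<theta>. L \<theta> (ls + \<mu>)) (\<Phi> (u, \<mu>)) = 0 \<longleftrightarrow> F u \<mu> = 0"
proof -
  have "linear (frechet_derivative (\<lambda>x. L (chart_inv c x) (ls + \<mu>)) (at (snd c (\<Phi> (u, \<mu>)))))"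
    by (rule has_derivative_linear[OF Ck_on_has_derivative[OF parameter_slice(5)[OF assms]]])
      (use k assms(3) in auto)
  then show ?thesis
    unfolding riem_grad_def o_def F_eq_0_iff_derivative[OF assms]
    by (rule sharp_metric_eq_0_iff[OF assms(1,3)])
qed

text \<open>The atlas covers the manifold, so the quantifier over charts in
  \<open>critical_point\<close> is never vacuous.\<close>

lemma critical_point_iff:
  assumes "(u, \<mu>) \<in> W"
  shows "critical_point A G (\<lambda>\<theta>. L \<theta> (ls + \<mu>)) (\<Phi> (u, \<mu>)) \<longleftrightarrow> F u \<mu> = 0"
  unfolding critical_point_def using riem_grad_eq_0_iff[OF _ assms] chart_cover by blast

text \<open>Pairing with a fixed vector gives a second derivative of a scalar function, to which
  symmetry and the pullback formula apply.\<close>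

lemma H_inner: "H v \<bullet> w = frechet_derivative (\<lambda>u. frechet_derivative (\<lambda>u. Lt (u, 0)) (at u) w) (at 0) v"
proof -
  have "Ck_on (Suc 0) W (\<lambda>(u, \<mu>). F u \<mu>)"
    by (rule Ck_on_le[OF Ck_F]) (use k in simp)
  from has_derivative_Pair_compose(1)[OF Ck_on_has_derivative[OF this _ W(2)]]
  have "(\<lambda>u. F u 0) differentiable (at 0)" by (auto simp: differentiable_def)
  then have "((\<lambda>u. F u 0 \<bullet> w) has_derivative (\<lambda>v. H v \<bullet> w)) (at 0)"
    by (intro has_derivative_inner_left) (simp add: frechet_derivative_works)
  then have "((\<lambda>u. frechet_derivative (\<lambda>u. Lt (u, 0)) (at u) w) has_derivative (\<lambda>v. H v \<bullet> w)) (at 0)"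
  proof (rule has_derivative_transform_within_open)
    show "open ((\<lambda>u. (u, 0)) -` W)" by (intro open_vimage W continuous_intros)
    show "F u 0 \<bullet> w = frechet_derivative (\<lambda>u. Lt (u, 0)) (at u) w" if "u \<in> (\<lambda>u. (u, 0)) -` W" for u
      using F_inner(2) that by simp
  qed (use W in simp)
  from frechet_derivative_at[OF this] show ?thesis by metis
qed

lemma H_symmetric: "H v \<bullet> w = v \<bullet> H w"
proof -
  let ?S = "(\<lambda>u. (u, 0)) -` W"
  have S: "open ?S" "0 \<in> ?S"
    using W by (auto intro!: open_vimage continuous_intros)
  have "Ck_on k ?S (\<lambda>u. Lt (u, 0))"
  proof (rule Ck_on_compose[where g = "\<lambda>u. (u, 0)" and f = Lt, OF S(1) _ _ Ck_Lt])
    show "Ck_on k ?S (\<lambda>u. (u, 0))" by (intro Ck_on_Pair[OF S(1)] Ck_on_ident Ck_on_const)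
  qed auto
  then have "Ck_on 2 ?S (\<lambda>u. Lt (u, 0))" by (rule Ck_on_le[OF _ k])
  from second_derivative_symmetric[OF S this] show ?thesis
    by (metis H_inner inner_commute)
qed

text \<open>At a critical point the Christoffel term vanishes, and both Hessians are one bilinear
  form up to the bijection D\<psi>. The kernel does not depend on the inner product that turns the
  form into an endomorphism.\<close>

lemma H_kernel:
  assumes c: "c \<in> A" "\<Phi> (0, 0) \<in> fst c" and F0: "F 0 0 = 0"
  shows "H v = 0 \<longleftrightarrow>
    riem_hess G c (\<lambda>\<theta>. L \<theta> ls) (\<Phi> (0, 0)) (frechet_derivative (\<lambda>u. snd c (\<Phi> (u, 0))) (at 0) v) = 0"
proof -
  let ?\<psi> = "\<lambda>u. snd c (\<Phi> (u, 0))" and ?h = "\<lambda>x. L (chart_inv c x) (ls + 0)"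
  let ?\<psi>' = "frechet_derivative ?\<psi> (at 0)"
  note ps = parameter_slice[OF c(1) W(2) c(2)]
  have h2: "Ck_on 2 (chart_image c) ?h" by (rule Ck_on_le[OF ps(5) k])
  have x0: "?\<psi> 0 \<in> chart_image c" using c(2) by auto
  have crit: "frechet_derivative ?h (at (?\<psi> 0)) = (\<lambda>_. 0)"
    using F_eq_0_iff_derivative[OF c(1) W(2) c(2)] F0 by auto
  let ?Q = "\<lambda>v w. frechet_derivative (\<lambda>y. frechet_derivative ?h (at y) w) (at (?\<psi> 0)) v"
  have Q: "riem_hess_form G c (\<lambda>\<theta>. L \<theta> ls) (\<Phi> (0, 0)) v = ?Q v" for v
    using crit by (simp add: riem_hess_form_def o_def Let_def fun_eq_iff)
  have pb: "frechet_derivative (\<lambda>u. frechet_derivative (\<lambda>u. ?h (?\<psi> u)) (at u) b) (at 0) v = ?Q (?\<psi>' v) (?\<psi>' b)" for b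
    by (rule second_derivative_pullback_critical[OF ps(1,2) chart(2)[OF c(1)] ps(3) ps(4) h2 crit])
  have cong: "frechet_derivative (\<lambda>u. frechet_derivative (\<lambda>u. ?h (?\<psi> u)) (at u) b) (at 0)
      = frechet_derivative (\<lambda>u. frechet_derivative (\<lambda>u. Lt (u, 0)) (at u) b) (at 0)" for b
  proof -
    let ?S = "{u. (u, 0) \<in> W \<inter> \<Phi> -` fst c}"
    have l2: "Ck_on (Suc (Suc 0)) ?S (\<lambda>u. ?h (?\<psi> u))"
      using Ck_on_compose[OF ps(1) ps(4) ps(3) h2] by (simp add: numeral_2_eq_2)
    have e: "frechet_derivative (\<lambda>u. ?h (?\<psi> u)) (at u) = frechet_derivative (\<lambda>u. Lt (u, 0)) (at u)"
      if "u \<in> ?S" for u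
      by (rule frechet_derivative_at[OF has_derivative_transform_within_open[OF
            Ck_on_has_derivative[OF l2 _ that] ps(1) that ps(6)]]) auto
    show ?thesis
      by (rule frechet_derivative_at[OF has_derivative_transform_within_open[OF
            Ck_on_has_derivative[OF Ck_on_derivative[OF l2] _ ps(2)] ps(1,2)]]) (simp_all only: e zero_less_Suc)
  qed
  have HQ: "H v \<bullet> b = ?Q (?\<psi>' v) (?\<psi>' b)" for b
    unfolding H_inner pb[symmetric] cong ..
  have "riem_hess G c (\<lambda>\<theta>. L \<theta> ls) (\<Phi> (0, 0)) (?\<psi>' v) = 0 \<longleftrightarrow> (\<forall>w. ?Q (?\<psi>' v) w = 0)"
    unfolding riem_hess_def Q
    by (rule sharp_metric_eq_0_iff[OF c linear_second_derivative[OF chart(2)[OF c(1)] x0 h2]])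
  also have "\<dots> \<longleftrightarrow> (\<forall>b. H v \<bullet> b = 0)"
  proof -
    have "(\<forall>w. P w) \<longleftrightarrow> (\<forall>b. P (?\<psi>' b))" for P
      using bij_is_surj[OF ps(7)] by (metis surjD)
    then show ?thesis unfolding HQ .
  qed
  also have "\<dots> \<longleftrightarrow> H v = 0"
    by (metis inner_eq_zero_iff inner_zero_left)
  finally show ?thesis by simp
qed

end

section \<open>Lyapunov-Schmidt reduction\<close>

lemma proj_N_inner:
  assumes "norm v0 = 1"
  shows "proj_N v0 x \<bullet> v0 = x \<bullet> v0"
  using assms by (simp add: proj_N_def dot_square_norm)

text \<open>The kernel lives in the chart \<open>c\<close> and \<open>v0\<close> in straightened
  coordinates, hence the derivative of the coordinate change in \<open>degeneracy\<close>. Both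
  branches are treated together by letting a range over 0 and \<alpha> \<mu>; the clause on
  \<open>w 0 \<mu>\<close> identifies the first with the given critical branch.\<close>

theorem theorem5p2:
  fixes A :: "('m::{t2_space,second_countable_topology}, 'e::euclidean_space) chart set"
    and G :: "('m, 'e) metric"
    and I :: "real set" and k :: nat
    and L :: "'m \<Rightarrow> real \<Rightarrow> real"
    and \<theta>0 :: "real \<Rightarrow> 'm" and ls :: real
    and c :: "('m, 'e) chart"
    and W :: "('e \<times> real) set" and \<Phi> :: "'e \<times> real \<Rightarrow> 'm"
    and v0 :: 'e
    and V :: "(real \<times> real) set" and w :: "real \<Rightarrow> real \<Rightarrow> 'e"
    and F :: "'e \<Rightarrow> real \<Rightarrow> 'e" and g :: "real \<Rightarrow> real \<Rightarrow> real"
  assumes manifold: "smooth_atlas A" "riemannian_metric A G"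
    and interval: "open I" "is_interval I" "{0..1} \<subseteq> I"
    and objective: "k \<ge> 4" "Ck_objective k A I L"
    and critical_branch: "smooth_into A I \<theta>0"
      "\<forall>l\<in>I. critical_point A G (\<lambda>\<theta>. L \<theta> l) (\<theta>0 l)"
    and degeneracy: "0 < ls" "ls < 1" "c \<in> A" "\<theta>0 ls \<in> fst c" "norm v0 = 1"
      "{v. riem_hess G c (\<lambda>\<theta>. L \<theta> ls) (\<theta>0 ls) v = 0}
         = span {frechet_derivative (\<lambda>u. snd c (\<Phi> (u, 0))) (at 0) v0}"
    and coordinates: "straightening A I \<theta>0 ls W \<Phi>"
    and F_def: "F = straightened_grad L ls \<Phi>"
    and reduction: "range_solution (k - 1) W F v0 V w"
    and g_def: "g = reduced_function F v0 w"
    and nondegenerate: "d_amu g 0 0 \<noteq> 0" "d_aa g 0 0 \<noteq> 0"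
  shows "(\<exists>\<kappa>. \<kappa> \<noteq> 0 \<and> transcritical_form (k - 1) V g \<kappa>) \<and>
    (\<exists>\<epsilon>>0. \<exists>\<alpha>.
       Ck_on (k - 2) {-\<epsilon><..<\<epsilon>} \<alpha> \<and> \<alpha> 0 = 0 \<and>
       (\<lambda>\<mu>. \<alpha> \<mu> - (- (2 * d_amu g 0 0 / d_aa g 0 0) * \<mu>)) \<in> O[at 0](\<lambda>\<mu>. \<mu> ^ 2) \<and>
       (\<forall>\<mu>\<in>{-\<epsilon><..<\<epsilon>}. \<Phi> (w 0 \<mu>, \<mu>) = \<theta>0 (ls + \<mu>)) \<and>
       (\<forall>\<mu>\<in>{-\<epsilon><..<\<epsilon>}. \<forall>a\<in>{0, \<alpha> \<mu>}.
          (a, \<mu>) \<in> V \<and> g a \<mu> = 0 \<and> F (a *\<^sub>R v0 + w a \<mu>) \<mu> = 0 \<and>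
          critical_point A G (\<lambda>\<theta>. L \<theta> (ls + \<mu>)) (\<Phi> (a *\<^sub>R v0 + w a \<mu>, \<mu>))))"
proof -
  interpret straightened_problem A G I k L \<theta>0 ls W \<Phi>
    using manifold interval objective coordinates by unfold_locales auto
  have W\<Phi>: "ls + \<mu> \<in> I" "\<Phi> (0, \<mu>) = \<theta>0 (ls + \<mu>)" if "(0, \<mu>) \<in> W" for \<mu>
    using coordinates that by (auto simp: straightening_def)
  have \<Phi>0: "\<Phi> (0, 0) = \<theta>0 ls" using W\<Phi>(2)[OF W(2)] by simp
  have F0: "F 0 \<mu> = 0" if "(0, \<mu>) \<in> W" for \<mu>
    using critical_point_iff[OF that] W\<Phi>[OF that] critical_branch(2) by (simp add: F_def)
  have v1: "v0 \<bullet> v0 = 1" using degeneracy(5) by (simp add: dot_square_norm)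
  let ?H = "frechet_derivative (\<lambda>u. F u 0) (at 0)"
  have sym: "?H v \<bullet> u = v \<bullet> ?H u" for v u
    unfolding F_def by (rule H_symmetric)
  \<comment> \<open>D\<psi> is a linear bijection, so the line of D\<psi> v0 in the chart pulls back
    to the line of \<open>v0\<close>.\<close>
  have ker: "{v. ?H v = 0} = span {v0}"
  proof -
    let ?\<psi>' = "frechet_derivative (\<lambda>u. snd c (\<Phi> (u, 0))) (at 0)"
    have c: "\<Phi> (0, 0) \<in> fst c" using \<Phi>0 degeneracy(4) by simp
    note ps = parameter_slice[OF degeneracy(3) W(2) c]
    have lin: "linear ?\<psi>'"
      by (rule has_derivative_linear[OF Ck_on_has_derivative[OF ps(4)[of 1] _ ps(2)]]) simp
    have "?H v = 0 \<longleftrightarrow> v \<in> span {v0}" for v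
    proof -
      have "?H v = 0 \<longleftrightarrow> riem_hess G c (\<lambda>\<theta>. L \<theta> ls) (\<Phi> (0, 0)) (?\<psi>' v) = 0"
        using H_kernel[OF degeneracy(3) c] F0[OF W(2)] by (simp add: F_def)
      also have "\<dots> \<longleftrightarrow> ?\<psi>' v \<in> span {?\<psi>' v0}"
        unfolding \<Phi>0 degeneracy(6)[symmetric] by simp
      also have "\<dots> \<longleftrightarrow> (\<exists>t. ?\<psi>' v = ?\<psi>' (t *\<^sub>R v0))"
        by (auto simp: span_singleton linear_cmul[OF lin])
      also have "\<dots> \<longleftrightarrow> v \<in> span {v0}"
        using inj_eq[OF bij_is_inj[OF ps(7)]] by (auto simp: span_singleton)
      finally show ?thesis .
    qed
    then show ?thesis by blast
  qed
  have Hv0: "?H v0 = 0" using ker span_base[of v0 "{v0}"] by auto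
  have CF: "Ck_on (k - 1) W (\<lambda>(u, \<mu>). F u \<mu>)"
    unfolding F_def by (rule Ck_F)
  have "Ck_on 1 W (\<lambda>(u, \<mu>). F u \<mu>)" by (rule Ck_on_le[OF CF]) (use objective(1) in linarith)
  from range_equation_unique[OF W this sym ker degeneracy(5)]
  obtain U where U: "open U" "(0, 0) \<in> U"
    and uniq: "\<And>u u' \<mu>. (u, \<mu>) \<in> U \<Longrightarrow> (u', \<mu>) \<in> U \<Longrightarrow> u \<bullet> v0 = u' \<bullet> v0 \<Longrightarrow>
      proj_R v0 (F u \<mu>) = proj_R v0 (F u' \<mu>) \<Longrightarrow> u = u'"
    by metis
  have V: "open V" "(0, 0) \<in> V" and Cw: "Ck_on (k - 1) V (\<lambda>(a, \<mu>). w a \<mu>)" and w0: "w 0 0 = 0"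
    and sol: "\<And>a \<mu>. (a, \<mu>) \<in> V \<Longrightarrow> w a \<mu> \<bullet> v0 = 0 \<and> (a *\<^sub>R v0 + w a \<mu>, \<mu>) \<in> W \<and>
      proj_R v0 (F (a *\<^sub>R v0 + w a \<mu>) \<mu>) = 0"
    using reduction by (auto simp: range_solution_def)
  \<comment> \<open>\<open>g\<close> is the component of F along \<open>v0\<close> composed with
    \<gamma>, which yields both its smoothness and its derivative.\<close>
  define \<gamma> where "\<gamma> p = (fst p *\<^sub>R v0 + case_prod w p, snd p)" for p
  have C\<gamma>: "Ck_on (k - 1) V \<gamma>"
    unfolding \<gamma>_def using V(1) Cw
    by (intro Ck_on_Pair Ck_on_add Ck_on_scaleR Ck_on_fst Ck_on_snd Ck_on_const) auto
  have \<gamma>W: "\<gamma> ` V \<subseteq> W" and \<gamma>0: "\<gamma> (0, 0) = (0, 0)"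
    using sol w0 by (auto simp: \<gamma>_def)
  have g: "case_prod g = (\<lambda>p. (case \<gamma> p of (u, \<mu>) \<Rightarrow> F u \<mu>) \<bullet> v0)"
    by (auto simp: g_def reduced_function_def proj_N_inner[OF degeneracy(5)] \<gamma>_def fun_eq_iff)
  have Cg: "Ck_on (k - 1) V (case_prod g)"
    unfolding g using Ck_on_compose[OF V(1) C\<gamma> \<gamma>W CF]
    by (intro Ck_on_inner[OF V(1)] Ck_on_const)
  have w_triv: "\<forall>\<^sub>F \<mu> in nhds 0. (0, \<mu>) \<in> V \<and> (0, \<mu>) \<in> W \<and> w 0 \<mu> = 0"
  proof -
    have ev: "\<forall>\<^sub>F \<mu> in nhds 0. (z, \<mu>) \<in> X" if "open X" "(z, 0) \<in> X"
      for X :: "('z::real_normed_vector \<times> real) set" and z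
    proof -
      have "open ((\<lambda>\<mu>. (z, \<mu>)) -` X)" using that by (intro open_vimage continuous_intros)
      from eventually_nhds_in_open[OF this, of 0] show ?thesis using that by simp
    qed
    \<comment> \<open>Uniqueness applies only while the point given by \<open>w\<close> stays in
      \<open>U\<close>; continuity of \<gamma> ensures this for small \<mu>.\<close>
    have "open (V \<inter> \<gamma> -` U)"
      using Ck_on_imp_continuous_on[OF C\<gamma>] V(1) U(1) by (rule continuous_open_preimage)
    from ev[OF this, of 0] ev[OF W] ev[OF U]
    have "\<forall>\<^sub>F \<mu> in nhds 0. (0, \<mu>) \<in> V \<inter> \<gamma> -` U \<and> (0, \<mu>) \<in> W \<and> (0, \<mu>) \<in> U"
      using V(2) U(2) \<gamma>0 by (simp add: eventually_conj_iff)
    then show ?thesis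
    proof eventually_elim
      case (elim \<mu>)
      have "w 0 \<mu> = 0"
      proof (rule uniq)
        show "(w 0 \<mu>, \<mu>) \<in> U" "(0, \<mu>) \<in> U" using elim by (simp_all add: \<gamma>_def)
        show "w 0 \<mu> \<bullet> v0 = 0 \<bullet> v0" using sol[of 0 \<mu>] elim by simp
        show "proj_R v0 (F (w 0 \<mu>) \<mu>) = proj_R v0 (F 0 \<mu>)"
          using sol[of 0 \<mu>] F0[of \<mu>] elim by (simp add: proj_R_def proj_N_def)
      qed
      with elim show ?case by simp
    qed
  qed
  have g_triv: "g 0 \<mu> = 0" if "(0, \<mu>) \<in> W" "w 0 \<mu> = 0" for \<mu>
    using that F0 by (simp add: g_def reduced_function_def proj_N_def)
  have ga: "frechet_derivative (case_prod g) (at (0, 0)) (1, 0) = 0"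
  proof -
    let ?F' = "frechet_derivative (\<lambda>(u, \<mu>). F u \<mu>) (at (0, 0))"
    let ?\<gamma>' = "frechet_derivative \<gamma> (at (0, 0))" and ?w' = "frechet_derivative (case_prod w) (at (0, 0))"
    have F': "((\<lambda>(u, \<mu>). F u \<mu>) has_derivative ?F') (at (\<gamma> (0, 0)))"
      unfolding \<gamma>0 by (rule Ck_on_has_derivative[OF CF _ W(2)]) (use objective(1) in simp)
    have "(case_prod w has_derivative ?w') (at (0, 0))"
      using Ck_on_has_derivative[OF Cw _ V(2)] objective(1) by simp
    then have "(\<gamma> has_derivative (\<lambda>p. (fst p *\<^sub>R v0 + ?w' p, snd p))) (at (0, 0))"
      unfolding \<gamma>_def[abs_def] by (auto intro!: derivative_eq_intros simp: case_prod_unfold)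
    from has_derivative_inner_left[OF has_derivative_compose[OF this F'], of v0]
    have "(case_prod g has_derivative (\<lambda>p. ?F' (fst p *\<^sub>R v0 + ?w' p, snd p) \<bullet> v0)) (at (0, 0))"
      unfolding g .
    from fun_cong[OF frechet_derivative_at[OF this], of "(1, 0)"]
    have "frechet_derivative (case_prod g) (at (0, 0)) (1, 0) = ?F' (v0 + ?w' (1, 0), 0) \<bullet> v0"
      by simp
    also have "?F' (v, 0) = ?H v" for v
      using fun_cong[OF frechet_derivative_at[OF has_derivative_Pair_compose(1)[OF F'[unfolded \<gamma>0]]], of v]
      by simp
    \<comment> \<open>Symmetry moves H onto \<open>v0\<close>, so w_a(0, 0) never has to be
      computed.\<close>
    also have "?H (v0 + ?w' (1, 0)) \<bullet> v0 = 0" unfolding sym Hv0 by simp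
    finally show ?thesis .
  qed
  \<comment> \<open>As k is at least 4, \<open>k - 4\<close> is true subtraction, and both orders
    take the successor form of the scalar result.\<close>
  obtain n where n: "k - 1 = Suc (Suc (Suc n))" "k - 2 = Suc (Suc n)"
    using objective(1) by (intro that[of "k - 4"]) auto
  have "\<forall>\<^sub>F \<mu> in nhds 0. g 0 \<mu> = 0"
    using w_triv by (rule eventually_mono) (blast intro: g_triv)
  note tb = transcritical_bifurcation[OF V Cg[unfolded n] this ga nondegenerate, folded n]
  obtain \<epsilon>1 where \<epsilon>1: "\<epsilon>1 > 0"
    and triv: "\<And>\<mu>. \<bar>\<mu>\<bar> < \<epsilon>1 \<Longrightarrow> (0, \<mu>) \<in> V" "\<And>\<mu>. \<bar>\<mu>\<bar> < \<epsilon>1 \<Longrightarrow> (0, \<mu>) \<in> W" "\<And>\<mu>. \<bar>\<mu>\<bar> < \<epsilon>1 \<Longrightarrow> w 0 \<mu> = 0"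
    using w_triv unfolding eventually_nhds_metric dist_real_def diff_0_right by blast
  obtain \<epsilon>2 \<alpha> where \<epsilon>2: "\<epsilon>2 > 0" and \<alpha>: "Ck_on (k - 2) {-\<epsilon>2<..<\<epsilon>2} \<alpha>" "\<alpha> 0 = 0"
    "(\<lambda>\<mu>. \<alpha> \<mu> - (- (2 * d_amu g 0 0 / d_aa g 0 0) * \<mu>)) \<in> O[at 0](\<lambda>\<mu>. \<mu> ^ 2)"
    "\<And>\<mu>. \<mu> \<in> {-\<epsilon>2<..<\<epsilon>2} \<Longrightarrow> (\<alpha> \<mu>, \<mu>) \<in> V \<and> g (\<alpha> \<mu>) \<mu> = 0"
    using tb(2) by blast
  define \<epsilon> where "\<epsilon> = min \<epsilon>1 \<epsilon>2"
  \<comment> \<open>A zero of \<open>g\<close> kills the component along \<open>v0\<close> and the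
    range equation kills the rest, so the full gradient vanishes.\<close>
  have crit: "F (a *\<^sub>R v0 + w a \<mu>) \<mu> = 0 \<and> critical_point A G (\<lambda>\<theta>. L \<theta> (ls + \<mu>)) (\<Phi> (a *\<^sub>R v0 + w a \<mu>, \<mu>))"
    if "(a, \<mu>) \<in> V" "g a \<mu> = 0" for a \<mu>
  proof -
    have "F (a *\<^sub>R v0 + w a \<mu>) \<mu> \<bullet> v0 = 0"
      using that(2) by (simp add: g_def reduced_function_def proj_N_inner[OF degeneracy(5)])
    then have "F (a *\<^sub>R v0 + w a \<mu>) \<mu> = 0"
      using sol[OF that(1)] by (simp add: proj_R_def proj_N_def)
    then show ?thesis
      using critical_point_iff sol[OF that(1)] by (simp add: F_def)
  qed
  have both: "(a, \<mu>) \<in> V \<and> g a \<mu> = 0" if "\<mu> \<in> {-\<epsilon><..<\<epsilon>}" "a \<in> {0, \<alpha> \<mu>}" for a \<mu>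
    using that triv[of \<mu>] g_triv[of \<mu>] \<alpha>(4)[of \<mu>] by (auto simp: \<epsilon>_def)
  have "\<Phi> (w 0 \<mu>, \<mu>) = \<theta>0 (ls + \<mu>)" if "\<mu> \<in> {-\<epsilon><..<\<epsilon>}" for \<mu>
    using that triv[of \<mu>] W\<Phi>(2)[of \<mu>] by (auto simp: \<epsilon>_def)
  moreover have "Ck_on (k - 2) {-\<epsilon><..<\<epsilon>} \<alpha>"
    by (rule Ck_on_subset[OF \<alpha>(1)]) (auto simp: \<epsilon>_def)
  moreover have "\<epsilon> > 0" using \<epsilon>1 \<epsilon>2 by (simp add: \<epsilon>_def)
  ultimately show ?thesis
    using tb(1) \<alpha>(2,3) both crit by blast
qed

end
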